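(* There is a universal constant $C_2>0$ such that the following holds. Let $m,d\ge2$ be even, $\gamma>1$, $\delta\in(0,1)$, and let $y_1,\dots,y_m\in\{\pm1\}$ with equally many labels $+1$ and $-1$. Consider the asymptotic dynamics of an over-parameterized quantum neural network with scaling factor $\gamma$ on a training set of mutually orthogonal pure states with labels $y_j$, and let $\lambda_g$ be the smallest eigenvalue of $\mathbf{K}_{\mathsf{asym}}$ at a global minimum. Then with probability at least $1-\delta$ over the uniform measure over all the global minima, $$\lambda_g\ \ge\ 2\gamma^2\Big(1-\frac1{\gamma^2}-C_2\max\Big\{\frac{m^2}{d},\ \frac md\log\frac2\delta\Big\}\Big),$$ and the right-hand side is strictly positive for large $\gamma>1$ and $d=\Omega(\mathrm{poly}(m))$. Here the global minima, the uniform measure and $\mathbf{K}_{\mathsf{asym}}$ are as follows. Write $\mathbb{C}^d=E_+\oplus E_-$ (orthogonal sum, $\dim E_\pm=d/2$), let $\boldsymbol\Pi_\pm$ be the orthogonal projection onto $E_\pm$ and $\mathbf{M}=\gamma(\boldsymbol\Pi_+-\boldsymbol\Pi_-)$. A global minimum is given by orthonormal vectors $\mathbf{v}_1,\dots,\mathbf{v}_m\in\mathbb{C}^d$ with $\mathbf{v}_j^\dagger\mathbf{M}\mathbf{v}_j=y_j$ for all $j$; then $\boldsymbol\rho_j=\mathbf{v}_j\mathbf{v}_j^\dagger$, $$(\mathbf{K}_{\mathsf{asym}})_{ij}=\operatorname{tr}\big(i[\mathbf{M},\boldsymbol\rho_i]\;i[\mathbf{M},\boldsymbol\rho_j]\big),$$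 and $\boldsymbol\Pi_+\mathbf{v}_j=\sqrt{\tfrac12(1+y_j/\gamma)}\;\hat{\mathbf{u}}_j$ for a unit vector $\hat{\mathbf{u}}_j\in E_+$. The probability statement means: if $\hat{\mathbf{u}}_1,\dots,\hat{\mathbf{u}}_m$ are drawn independently and uniformly from the unit sphere of $E_+$, then with probability at least $1-\delta$ the bound holds for every global minimum whose positive-subspace directions are $\hat{\mathbf{u}}_1,\dots,\hat{\mathbf{u}}_m$.
   Context: Setting: the network has measurement $\gamma\mathbf{M}_0$ with $\mathbf{M}_0$ a Pauli measurement (Hermitian, eigenvalues $\pm1$, trace $0$), prediction $\hat y_j=\operatorname{tr}(\boldsymbol\rho_j\mathbf{M}(t))$ for input state $\boldsymbol\rho_j$, and loss $L=\frac1{2m}\sum_j(\hat y_j-y_j)^2$. In the asymptotic (infinitely many parameters) dynamics $\mathbf{M}(t)$ evolves by $\frac{d}{dt}\mathbf{M}(t)=\sum_j r_j[\mathbf{M}(t),[\mathbf{M}(t),\boldsymbol\rho_j]]$ with $r_j=y_j-\hat y_j$, so it stays unitarily conjugate to $\gamma\mathbf{M}_0$, and global minima are the configurations with $L=0$. Everything depends only on the relative position of $\mathbf{M}$ and the states, so one may describe a global minimum by fixing $\mathbf{M}$ and letting the orthonormal state vectors $\mathbf{v}_j$ vary. The condition $L=0$ forces $\|\boldsymbol\Pi_+\mathbf{v}_j\|^2=\frac12(1+y_j/\gamma)$. $[\mathbf A,\mathbf B]=\mathbf{AB}-\mathbf{BA}$, and the factor $i$ multiplying commutators is the imaginary unit.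 The positivity remark means: for fixed $\delta$ there are $\gamma_0>1$ and a polynomial $q$ such that the right-hand side is positive whenever $\gamma\ge\gamma_0$ and $d\ge q(m)$. *)

theory Defs
  imports "HOL-Probability.Probability" "Jordan_Normal_Form.Char_Poly"
begin

unbundle no vec_syntax

text \<open>
  Since the dimension is quantified inside the statement (after the universal constant), vectors
  of \<open>\<complex>\<^sup>d\<close> and matrices are those of \<open>Jordan_Normal_Form\<close>.  The library product
  \<open>v \<bullet>c w\<close> is conjugate-linear in its second argument, so \<open>w\<^sup>\<dagger> v\<close> is \<open>v \<bullet>c w\<close>.
\<close>

definition orthonormal_family :: "nat \<Rightarrow> nat \<Rightarrow> (nat \<Rightarrow> complex vec) \<Rightarrow> bool" where
  "orthonormal_family d k v \<longleftrightarrow>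
     (\<forall>i<k. v i \<in> carrier_vec d) \<and>
     (\<forall>i<k. \<forall>j<k. v i \<bullet>c v j = (if i = j then 1 else 0))"

text \<open>
  An orthogonal decomposition \<open>\<complex>\<^sup>d = E\<^sub>+ \<oplus> E\<^sub>-\<close> into two subspaces of dimension \<open>d/2\<close> is given by
  orthonormal bases \<open>e\<close> of \<open>E\<^sub>+\<close> and \<open>f\<close> of \<open>E\<^sub>-\<close>.
\<close>

definition half_split :: "nat \<Rightarrow> (nat \<Rightarrow> complex vec) \<Rightarrow> (nat \<Rightarrow> complex vec) \<Rightarrow> bool" where
  "half_split d e f \<longleftrightarrow>
     orthonormal_family d (d div 2) e \<and> orthonormal_family d (d div 2) f \<and>
     (\<forall>k<d div 2. \<forall>l<d div 2. e k \<bullet>c f l = 0)"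

definition ketbra :: "nat \<Rightarrow> complex vec \<Rightarrow> complex mat" where
  "ketbra d v = mat d d (\<lambda>(r, c). v $ r * cnj (v $ c))"

text \<open>The orthogonal projection onto the span of an orthonormal family, \<open>\<Sum>k<n. e\<^sub>k e\<^sub>k\<^sup>\<dagger>\<close>.\<close>

definition proj_onto :: "nat \<Rightarrow> nat \<Rightarrow> (nat \<Rightarrow> complex vec) \<Rightarrow> complex mat" where
  "proj_onto d n e = mat d d (\<lambda>(r, c). \<Sum>k<n. ketbra d (e k) $$ (r, c))"

definition measurement ::
  "nat \<Rightarrow> real \<Rightarrow> (nat \<Rightarrow> complex vec) \<Rightarrow> (nat \<Rightarrow> complex vec) \<Rightarrow> complex mat" where
  "measurement d \<gamma> e f =
     complex_of_real \<gamma> \<cdot>\<^sub>m (proj_onto d (d div 2) e - proj_onto d (d div 2) f)"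

definition global_min ::
  "nat \<Rightarrow> nat \<Rightarrow> complex mat \<Rightarrow> (nat \<Rightarrow> real) \<Rightarrow> (nat \<Rightarrow> complex vec) \<Rightarrow> bool" where
  "global_min d m M y v \<longleftrightarrow>
     orthonormal_family d m v \<and>
     (\<forall>j<m. (M *\<^sub>v v j) \<bullet>c v j = complex_of_real (y j))"

definition commutator :: "complex mat \<Rightarrow> complex mat \<Rightarrow> complex mat" where
  "commutator A B = A * B - B * A"

definition mat_trace :: "complex mat \<Rightarrow> complex" where
  "mat_trace A = (\<Sum>i<dim_row A. A $$ (i, i))"

definition K_asym :: "nat \<Rightarrow> nat \<Rightarrow> complex mat \<Rightarrow> (nat \<Rightarrow> complex vec) \<Rightarrow> complex mat" where
  "K_asym d m M v = mat m m (\<lambda>(i, j).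
     mat_trace ((\<i> \<cdot>\<^sub>m commutator M (ketbra d (v i))) * (\<i> \<cdot>\<^sub>m commutator M (ketbra d (v j)))))"

text \<open>Meant for Hermitian matrices, all of whose eigenvalues are real.\<close>

definition min_eigenvalue :: "complex mat \<Rightarrow> real" where
  "min_eigenvalue A = Min {x. eigenvalue A (complex_of_real x)}"

text \<open>
  The uniform probability measure on the unit sphere of \<open>\<complex>\<^sup>n\<close>, in coordinates \<open>{..<n}\<close>: the image
  of the normalised Lebesgue measure on the unit ball of \<open>\<complex>\<^sup>n = \<real>\<^sup>2\<^sup>n\<close> under \<open>z \<mapsto> z / \<parallel>z\<parallel>\<close>
  (normalised cone measure, which on the Euclidean sphere is normalised surface measure).
  The origin, where division by zero yields \<open>0\<close>, is a null set for \<open>n \<ge> 1\<close>.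
\<close>

definition coord_norm :: "nat \<Rightarrow> (nat \<Rightarrow> complex) \<Rightarrow> real" where
  "coord_norm n z = sqrt (\<Sum>k<n. (cmod (z k))\<^sup>2)"

definition uniform_sphere :: "nat \<Rightarrow> (nat \<Rightarrow> complex) measure" where
  "uniform_sphere n =
     distr
       (uniform_measure (Pi\<^sub>M {..<n} (\<lambda>_. lborel))
          {z \<in> space (Pi\<^sub>M {..<n} (\<lambda>_. lborel)). coord_norm n z \<le> 1})
       (Pi\<^sub>M {..<n} (\<lambda>_. borel))
       (\<lambda>z. \<lambda>k\<in>{..<n}. z k / complex_of_real (coord_norm n z))"

text \<open>
  If \<open>e\<close> is an orthonormal basis of \<open>E\<close>, then \<open>from_coords d n e\<close> is a linear isometry of \<open>\<complex>\<^sup>n\<close>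
  onto \<open>E\<close> and carries \<open>uniform_sphere n\<close> to the uniform measure on the unit sphere of \<open>E\<close>
  (which does not depend on the basis, by unitary invariance).
\<close>

definition from_coords :: "nat \<Rightarrow> nat \<Rightarrow> (nat \<Rightarrow> complex vec) \<Rightarrow> (nat \<Rightarrow> complex) \<Rightarrow> complex vec" where
  "from_coords d n e z = vec d (\<lambda>r. \<Sum>k<n. z k * e k $ r)"

definition eig_bound :: "real \<Rightarrow> real \<Rightarrow> real \<Rightarrow> nat \<Rightarrow> nat \<Rightarrow> real" where
  "eig_bound C \<gamma> \<delta> m d =
     2 * \<gamma>\<^sup>2 * (1 - 1 / \<gamma>\<^sup>2 - C * max ((real m)\<^sup>2 / real d) (real m / real d * ln (2 / \<delta>)))"

end

theory Submission
  imports Defs "Jordan_Normal_Form.Spectral_Radius"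
begin

text \<open>
  Since \<open>M\<^sup>2 = \<gamma>\<^sup>2\<close>, expanding the commutators gives
  \<open>K\<^sub>i\<^sub>j = 2 \<gamma>\<^sup>2 \<delta>\<^sub>i\<^sub>j - 2 |v\<^sub>i\<^sup>\<dagger> M v\<^sub>j|\<^sup>2\<close>.  The diagonal entries are \<open>2 \<gamma>\<^sup>2 - 2\<close>;
  off the diagonal, orthogonality of \<open>v\<^sub>i\<close> and \<open>v\<^sub>j\<close> turns \<open>v\<^sub>i\<^sup>\<dagger> M v\<^sub>j\<close> into
  \<open>2 \<gamma>\<close> times the overlap of the \<open>E\<^sub>+\<close>-parts, so \<open>|K\<^sub>i\<^sub>j| \<le> 8 \<gamma>\<^sup>2 |\<langle>u\<^sub>i, u\<^sub>j\<rangle>|\<^sup>2\<close> and Gershgorin's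
  theorem bounds the spectrum from below.  For \<open>u\<close> uniform on the sphere of \<open>\<complex>\<^sup>n\<close>, \<open>n = d/2\<close>,
  the tail \<open>P(|\<langle>u, w\<rangle>|\<^sup>2 > t) \<le> 4 exp (- n t / 2)\<close> comes from the elementary spherical cap
  estimate: the cone over a cap of height \<open>a\<close>, cut at radius \<open>1\<close>, lies in a ball of radius
  \<open>sqrt (1 - a\<^sup>2)\<close> about \<open>a w\<close>.  A union bound over the pairs \<open>i \<noteq> j\<close> finishes the argument.
\<close>

subsection \<open>Uniform vectors on the complex sphere\<close>

definition coord_dot :: "nat \<Rightarrow> (nat \<Rightarrow> complex) \<Rightarrow> (nat \<Rightarrow> complex) \<Rightarrow> complex" where
  "coord_dot n z w = (\<Sum>k<n. z k * cnj (w k))"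

lemma coord_norm_nonneg: "0 \<le> coord_norm n z"
  by (simp add: coord_norm_def sum_nonneg)

lemma coord_norm_sq: "(coord_norm n z)\<^sup>2 = (\<Sum>k<n. (cmod (z k))\<^sup>2)"
  by (simp add: coord_norm_def sum_nonneg)

lemma coord_norm_scale: "coord_norm n (\<lambda>k. c * z k) = cmod c * coord_norm n z"
  by (simp add: coord_norm_def norm_mult power_mult_distrib flip: sum_distrib_left)
    (simp add: real_sqrt_mult)

lemma coord_norm_cong: "(\<And>k. k < n \<Longrightarrow> z k = w k) \<Longrightarrow> coord_norm n z = coord_norm n w"
  by (simp add: coord_norm_def)

lemma coord_dot_cong:
  "(\<And>k. k < n \<Longrightarrow> z k = z' k) \<Longrightarrow> (\<And>k. k < n \<Longrightarrow> w k = w' k) \<Longrightarrow> coord_dot n z w = coord_dot n z' w'"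
  by (simp add: coord_dot_def)

lemma coord_dot_scale: "coord_dot n (\<lambda>k. c * z k) (\<lambda>k. b * w k) = c * cnj b * coord_dot n z w"
  by (simp add: coord_dot_def sum_distrib_left mult_ac)

text \<open>The squared distance from \<open>z\<close> to the point \<open>a w\<close>, the centre
  of the ball that will enclose a spherical cap.\<close>

lemma coord_norm_diff_sq:
  "(coord_norm n (\<lambda>k. z k - complex_of_real a * w k))\<^sup>2 =
     (coord_norm n z)\<^sup>2 - 2 * a * Re (coord_dot n z w) + a\<^sup>2 * (coord_norm n w)\<^sup>2"
proof -
  have "(cmod (x - complex_of_real a * y))\<^sup>2 = (cmod x)\<^sup>2 - 2 * a * Re (x * cnj y) + a\<^sup>2 * (cmod y)\<^sup>2"
    for x y :: complex
    unfolding cmod_power2 by (simp add: power2_eq_square algebra_simps)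
  then show ?thesis
    by (simp add: coord_norm_sq coord_dot_def sum.distrib sum_subtractf sum_distrib_left distrib_left)
qed

lemma coord_dot_Cauchy_Schwarz:
  "(cmod (coord_dot n z w))\<^sup>2 \<le> (coord_norm n z)\<^sup>2 * (coord_norm n w)\<^sup>2"
proof -
  have "cmod (coord_dot n z w) \<le> (\<Sum>k<n. cmod (z k) * cmod (w k))"
    unfolding coord_dot_def by (rule norm_sum[THEN order_trans]) (simp add: norm_mult)
  then have "(cmod (coord_dot n z w))\<^sup>2 \<le> (\<Sum>k<n. cmod (z k) * cmod (w k))\<^sup>2"
    by (simp add: power_mono)
  also have "\<dots> \<le> (coord_norm n z)\<^sup>2 * (coord_norm n w)\<^sup>2"
    unfolding coord_norm_sq by (rule Cauchy_Schwarz_ineq_sum)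
  finally show ?thesis .
qed

section \<open>Lebesgue measure on complex n-space: scaling, the unit ball, caps\<close>

abbreviation lborel_prod :: "nat \<Rightarrow> (nat \<Rightarrow> complex) measure" where
  "lborel_prod n \<equiv> Pi\<^sub>M {..<n} (\<lambda>_. lborel)"

definition unit_ball :: "nat \<Rightarrow> (nat \<Rightarrow> complex) set" where
  "unit_ball n = {z \<in> space (lborel_prod n). coord_norm n z \<le> 1}"

interpretation lborel_product: product_sigma_finite "\<lambda>_::nat. lborel :: complex measure"
  by unfold_locales

lemma measurable_coord_norm [measurable]:
  assumes "\<And>k. k < n \<Longrightarrow> (\<lambda>x. z x k) \<in> borel_measurable M"
  shows "(\<lambda>x. coord_norm n (z x)) \<in> borel_measurable M"
proof -
  have "(\<lambda>x. \<Sum>k<n. (cmod (z x k))\<^sup>2) \<in> borel_measurable M"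
    using assms by (intro borel_measurable_sum borel_measurable_power borel_measurable_norm) auto
  then show ?thesis unfolding coord_norm_def by measurable
qed

lemma measurable_coord_dot [measurable]:
  assumes "\<And>k. k < n \<Longrightarrow> (\<lambda>x. z x k) \<in> borel_measurable M"
    and "\<And>k. k < n \<Longrightarrow> (\<lambda>x. w x k) \<in> borel_measurable M"
  shows "(\<lambda>x. coord_dot n (z x) (w x)) \<in> borel_measurable M"
proof -
  have "(\<lambda>x. cnj (w x k)) \<in> borel_measurable M" if "k < n" for k
    by (rule measurable_compose[OF assms(2)[OF that]])
      (intro borel_measurable_continuous_onI continuous_intros)
  then show ?thesis
    unfolding coord_dot_def using assms by (intro borel_measurable_sum borel_measurable_times) auto
qed

lemma component_measurable [measurable]:
  "k < n \<Longrightarrow> (\<lambda>z. z k) \<in> borel_measurable (lborel_prod n)"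
  using measurable_component_singleton[of k "{..<n}" "\<lambda>_. lborel :: complex measure"] by simp

lemma unit_ball_measurable [measurable]: "unit_ball n \<in> sets (lborel_prod n)"
  unfolding unit_ball_def by measurable

lemma emeasure_lborel_affine_complex:
  fixes A :: "complex set"
  assumes "r > 0" "A \<in> sets borel"
  shows "emeasure lborel A = ennreal (r\<^sup>2) * emeasure lborel ((\<lambda>x. t + r *\<^sub>R x) -` A)"
proof -
  have "emeasure lborel A
      = emeasure (density (distr lborel borel (\<lambda>x. t + r *\<^sub>R x)) (\<lambda>_. ennreal (\<bar>r\<bar> ^ DIM(complex)))) A"
    using assms lborel_affine[of r t] by simp
  also have "\<dots> = ennreal (r\<^sup>2) * emeasure lborel ((\<lambda>x. t + r *\<^sub>R x) -` A)"
    using assms by (simp add: emeasure_density_const emeasure_distr)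
  finally show ?thesis .
qed

text \<open>Each complex coordinate has real dimension 2 and contributes \<open>r^2\<close>, so
  volume scales by \<open>r^(2n)\<close>; this is what turns a smaller radius into an exponentially
  small volume.\<close>

lemma emeasure_lborel_prod_affine:
  assumes r: "r > 0" and S: "S \<in> sets (lborel_prod n)"
  shows "emeasure (lborel_prod n) S = ennreal (r ^ (2 * n)) *
    emeasure (lborel_prod n) ((\<lambda>z. \<lambda>k\<in>{..<n}. w k + r *\<^sub>R z k) -` S \<inter> space (lborel_prod n))"
proof -
  define T where "T = (\<lambda>z. \<lambda>k\<in>{..<n}. w k + r *\<^sub>R (z k :: complex))"
  have T [measurable]: "T \<in> measurable (lborel_prod n) (lborel_prod n)"
    unfolding T_def by measurable
  let ?D = "scale_measure (ennreal (r ^ (2 * n))) (distr (lborel_prod n) (lborel_prod n) T)"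
  \<comment> \<open>A product measure is determined by its values on boxes, and on a box the affine
    map acts coordinatewise.\<close>
  have "?D = lborel_prod n"
  proof (rule lborel_product.PiM_eqI)
    fix A :: "nat \<Rightarrow> complex set"
    assume A: "\<And>i. i \<in> {..<n} \<Longrightarrow> A i \<in> sets lborel"
    have pre: "T -` (Pi\<^sub>E {..<n} A) \<inter> space (lborel_prod n)
        = Pi\<^sub>E {..<n} (\<lambda>k. (\<lambda>x. w k + r *\<^sub>R x) -` A k)"
      by (auto simp: T_def space_PiM PiE_iff extensional_def)
    have meas: "(\<lambda>x. w k + r *\<^sub>R x) -` A k \<in> sets borel" if "k < n" for k
    proof -
      have "(\<lambda>x. w k + r *\<^sub>R x) \<in> borel_measurable borel" by measurable
      from measurable_sets_borel[OF this, of "A k"] show ?thesis using A[of k] that by simp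
    qed
    have "emeasure ?D (Pi\<^sub>E {..<n} A) = ennreal (r ^ (2 * n)) *
        (\<Prod>k<n. emeasure lborel ((\<lambda>x. w k + r *\<^sub>R x) -` A k))"
      using A meas lborel_product.emeasure_PiM[of "{..<n}" "\<lambda>k. (\<lambda>x. w k + r *\<^sub>R x) -` A k"]
      by (simp add: emeasure_distr pre sets_PiM_I_finite)
    also have "\<dots> = (\<Prod>k<n. ennreal (r\<^sup>2)) *
        (\<Prod>k<n. emeasure lborel ((\<lambda>x. w k + r *\<^sub>R x) -` A k))"
      using r by (simp add: power_mult ennreal_power)
    also have "\<dots> = (\<Prod>k<n. emeasure lborel (A k))"
      unfolding prod.distrib[symmetric]
      using A r by (intro prod.cong refl emeasure_lborel_affine_complex[symmetric]) auto
    finally show "emeasure ?D (Pi\<^sub>E {..<n} A) = (\<Prod>i\<in>{..<n}. emeasure lborel (A i))" .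
  qed auto
  then have "emeasure (lborel_prod n) S = emeasure ?D S" by simp
  also have "\<dots> = ennreal (r ^ (2 * n)) * emeasure (lborel_prod n) (T -` S \<inter> space (lborel_prod n))"
    using S by (simp add: emeasure_distr)
  finally show ?thesis by (simp add: T_def)
qed

text \<open>The ball sits in a polydisc, whose volume is a product. With the lower bound
  \<open>emeasure_unit_ball_pos\<close>, this makes the normalised measure on the ball a probability
  measure.\<close>

lemma emeasure_unit_ball_finite: "emeasure (lborel_prod n) (unit_ball n) < \<infinity>"
proof -
  have "unit_ball n \<subseteq> Pi\<^sub>E {..<n} (\<lambda>_. cball 0 1)"
  proof
    fix z assume z: "z \<in> unit_ball n"
    have "cmod (z k) \<le> 1" if "k < n" for k
    proof -
      have "(cmod (z k))\<^sup>2 \<le> (coord_norm n z)\<^sup>2"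
        unfolding coord_norm_sq using that by (intro member_le_sum) auto
      then have "cmod (z k) \<le> coord_norm n z"
        by (rule power2_le_imp_le) (rule coord_norm_nonneg)
      with z show ?thesis by (simp add: unit_ball_def)
    qed
    with z show "z \<in> Pi\<^sub>E {..<n} (\<lambda>_. cball 0 1)"
      by (auto simp: unit_ball_def space_PiM PiE_iff)
  qed
  then have "emeasure (lborel_prod n) (unit_ball n)
      \<le> emeasure (lborel_prod n) (Pi\<^sub>E {..<n} (\<lambda>_. cball 0 1))"
    by (intro emeasure_mono) (auto intro!: sets_PiM_I_finite)
  also have "\<dots> = (\<Prod>k<n. emeasure lborel (cball (0::complex) 1))"
    by (subst lborel_product.emeasure_PiM) auto
  also have "\<dots> < \<infinity>"
    using emeasure_lborel_cball_finite[of "0::complex" 1]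
    by (simp add: power_less_top_ennreal)
  finally show ?thesis .
qed

lemma emeasure_unit_ball_pos: "emeasure (lborel_prod n) (unit_ball n) > 0"
\<comment> \<open>For \<open>n = 0\<close> the space is a single point of mass one. Otherwise the
  polydisc of radius \<open>1/n\<close> fits inside the ball, since each of the n squares is at most
  \<open>1/n\<close>.\<close>
proof (cases "n = 0")
  case True
  then have "unit_ball n = {\<lambda>_. undefined}" "lborel_prod n = count_space {\<lambda>_. undefined}"
    by (auto simp: unit_ball_def space_PiM coord_norm_def PiM_empty)
  then show ?thesis by simp
next
  case False
  have "Pi\<^sub>E {..<n} (\<lambda>_. cball 0 (1 / real n)) \<subseteq> unit_ball n"
  proof
    fix z :: "nat \<Rightarrow> complex" assume z: "z \<in> Pi\<^sub>E {..<n} (\<lambda>_. cball 0 (1 / real n))"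
    have "(\<Sum>k<n. (cmod (z k))\<^sup>2) \<le> (\<Sum>k<n. 1 / real n)"
    proof (rule sum_mono)
      fix k assume "k \<in> {..<n}"
      then have "cmod (z k) \<le> 1 / real n" using z by (auto simp: PiE_iff)
      then have "(cmod (z k))\<^sup>2 \<le> (1 / real n)\<^sup>2" by (simp add: power_mono)
      also have "\<dots> \<le> 1 / real n" using False by (simp add: power2_eq_square field_simps)
      finally show "(cmod (z k))\<^sup>2 \<le> 1 / real n" .
    qed
    then have "coord_norm n z \<le> 1" using False by (simp add: coord_norm_def)
    with z show "z \<in> unit_ball n" by (auto simp: unit_ball_def space_PiM PiE_iff)
  qed
  then have "emeasure (lborel_prod n) (Pi\<^sub>E {..<n} (\<lambda>_. cball 0 (1 / real n)))
      \<le> emeasure (lborel_prod n) (unit_ball n)"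
    by (intro emeasure_mono) auto
  moreover have "emeasure (lborel_prod n) (Pi\<^sub>E {..<n} (\<lambda>_. cball 0 (1 / real n)))
      = emeasure lborel (cball (0::complex) (1 / real n)) ^ n"
    by (subst lborel_product.emeasure_PiM) auto
  moreover have "emeasure lborel (cball (0::complex) (1 / real n)) > 0"
    using False by (simp add: emeasure_cball unit_ball_vol_pos)
  ultimately show ?thesis
    by (metis bot.not_eq_extremum bot_ennreal leD power_not_zero)
qed

lemma prob_space_uniform_ball: "prob_space (uniform_measure (lborel_prod n) (unit_ball n))"
  using emeasure_unit_ball_pos[of n] emeasure_unit_ball_finite[of n]
  by (intro prob_space_uniform_measure) auto

text \<open>With \<open>s\<close> the norm of \<open>z\<close>, the squared distance from
  \<open>z\<close> to \<open>a w\<close> is at most \<open>s^2 - 2 a^2 s + a^2\<close>. This is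
  convex in \<open>s\<close>, with value \<open>a^2\<close> at 0 and \<open>1 - a^2\<close> at 1;
  the assumption \<open>a^2 <= 1/2\<close> makes the second the larger one.\<close>

lemma emeasure_cap_le:
  assumes a: "0 \<le> a" "a\<^sup>2 \<le> 1/2" and w: "coord_norm n w = 1"
  shows "emeasure (lborel_prod n) {z \<in> unit_ball n. a * coord_norm n z \<le> Re (coord_dot n z w)}
      \<le> ennreal ((1 - a\<^sup>2) ^ n) * emeasure (lborel_prod n) (unit_ball n)"
proof -
  define r where "r = sqrt (1 - a\<^sup>2)"
  have r: "r > 0" "r\<^sup>2 = 1 - a\<^sup>2" using a by (auto simp: r_def)
  let ?B = "{z \<in> space (lborel_prod n). coord_norm n (\<lambda>k. z k - complex_of_real a * w k) \<le> r}"
  have B: "?B \<in> sets (lborel_prod n)" by measurable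
  have "{z \<in> unit_ball n. a * coord_norm n z \<le> Re (coord_dot n z w)} \<subseteq> ?B"
  proof
    fix z assume "z \<in> {z \<in> unit_ball n. a * coord_norm n z \<le> Re (coord_dot n z w)}"
    then have z: "z \<in> space (lborel_prod n)" "coord_norm n z \<le> 1"
      "a * coord_norm n z \<le> Re (coord_dot n z w)" by (auto simp: unit_ball_def)
    define s where "s = coord_norm n z"
    have s: "0 \<le> s" "s \<le> 1" using z coord_norm_nonneg by (auto simp: s_def)
    have "(coord_norm n (\<lambda>k. z k - complex_of_real a * w k))\<^sup>2
        = s\<^sup>2 - 2 * a * Re (coord_dot n z w) + a\<^sup>2"
      by (simp add: coord_norm_diff_sq w s_def)
    also have "\<dots> \<le> s\<^sup>2 - 2 * a * (a * s) + a\<^sup>2"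
      using z(3) a(1) by (simp add: s_def mult_left_mono)
    \<comment> \<open>The factor \<open>1 - s\<close> exhibits the maximum at \<open>s = 1\<close>;
      the other factor is nonnegative because \<open>a^2 <= 1/2\<close>.\<close>
    also have "\<dots> = (1 - a\<^sup>2) - (1 - s) * (s + (1 - 2 * a\<^sup>2))"
      by (simp add: power2_eq_square algebra_simps)
    also have "\<dots> \<le> r\<^sup>2"
      using s a r(2) mult_nonneg_nonneg[of "1 - s" "s + (1 - 2 * a\<^sup>2)"] by simp
    finally have "coord_norm n (\<lambda>k. z k - complex_of_real a * w k) \<le> r"
      by (rule power2_le_imp_le) (use r(1) in simp)
    with z(1) show "z \<in> ?B" by simp
  qed
  then have "emeasure (lborel_prod n) {z \<in> unit_ball n. a * coord_norm n z \<le> Re (coord_dot n z w)}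
      \<le> emeasure (lborel_prod n) ?B"
    using B by (rule emeasure_mono)
  \<comment> \<open>The map sending \<open>z\<close> to \<open>a w + r z\<close> pulls the enclosing
    ball back to the unit ball, so the two volumes are compared without computing either.\<close>
  also have "\<dots> = ennreal (r ^ (2 * n)) * emeasure (lborel_prod n)
     ((\<lambda>z. \<lambda>k\<in>{..<n}. complex_of_real a * w k + r *\<^sub>R z k) -` ?B \<inter> space (lborel_prod n))"
    by (rule emeasure_lborel_prod_affine[OF r(1) B, of "\<lambda>k. complex_of_real a * w k"])
  also have "(\<lambda>z. \<lambda>k\<in>{..<n}. complex_of_real a * w k + r *\<^sub>R z k) -` ?B \<inter> space (lborel_prod n)
      = unit_ball n"
  proof -
    have "coord_norm n (\<lambda>k. (\<lambda>k\<in>{..<n}. complex_of_real a * w k + r *\<^sub>R z k) k - complex_of_real a * w k)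
        = r * coord_norm n z" for z
    proof -
      have "coord_norm n (\<lambda>k. (\<lambda>k\<in>{..<n}. complex_of_real a * w k + r *\<^sub>R z k) k - complex_of_real a * w k)
          = coord_norm n (\<lambda>k. complex_of_real r * z k)"
        by (rule coord_norm_cong) (simp add: scaleR_conv_of_real)
      then show ?thesis using r(1) by (simp add: coord_norm_scale)
    qed
    then show ?thesis
      using r(1) by (auto simp: unit_ball_def space_PiM PiE_iff extensional_def)
  qed
  finally show ?thesis using r(2) by (simp add: power_mult)
qed

text \<open>The larger of the absolute real and imaginary parts is at least the modulus over the
  square root of 2. The four rotations cover both signs of both parts, which is the origin of the
  factor 4 in the tail bound.\<close>

lemma Re_or_Im_ge:
  fixes c :: complex
  assumes "2 * a\<^sup>2 \<le> (cmod c)\<^sup>2" "0 \<le> a"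
  shows "a \<le> Re c \<or> a \<le> Re (- c) \<or> a \<le> Re (\<i> * c) \<or> a \<le> Re (- \<i> * c)"
proof (rule ccontr)
  assume "\<not> ?thesis"
  then have "\<bar>Re c\<bar> < a" "\<bar>Im c\<bar> < a" by auto
  then have "(Re c)\<^sup>2 < a\<^sup>2" "(Im c)\<^sup>2 < a\<^sup>2"
    using power_strict_mono[of "\<bar>Re c\<bar>" a 2] power_strict_mono[of "\<bar>Im c\<bar>" a 2] by simp_all
  then show False using assms(1) by (simp add: cmod_power2)
qed

section \<open>The uniform measure on the sphere, overlap tails and independent tuples\<close>

lemma uniform_sphere_altdef:
  "uniform_sphere n = distr (uniform_measure (lborel_prod n) (unit_ball n)) (Pi\<^sub>M {..<n} (\<lambda>_. borel))
     (\<lambda>z. \<lambda>k\<in>{..<n}. z k / complex_of_real (coord_norm n z))"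
  by (simp add: uniform_sphere_def unit_ball_def)

lemma normalise_measurable [measurable]:
  "(\<lambda>z. \<lambda>k\<in>{..<n}. z k / complex_of_real (coord_norm n z)) \<in>
     measurable (lborel_prod n) (Pi\<^sub>M {..<n} (\<lambda>_. borel))"
  by measurable

lemma sets_uniform_sphere [measurable_cong]: "sets (uniform_sphere n) = sets (Pi\<^sub>M {..<n} (\<lambda>_. borel))"
  by (simp add: uniform_sphere_def)

lemma space_uniform_sphere: "space (uniform_sphere n) = space (Pi\<^sub>M {..<n} (\<lambda>_. borel))"
  by (simp add: uniform_sphere_def)

lemma prob_space_uniform_sphere: "prob_space (uniform_sphere n)"
  unfolding uniform_sphere_altdef
  by (rule prob_space.prob_space_distr[OF prob_space_uniform_ball]) simp

lemma sphere_component_measurable [measurable]: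
  "k < n \<Longrightarrow> (\<lambda>z. z k) \<in> borel_measurable (Pi\<^sub>M {..<n} (\<lambda>_. borel :: complex measure))"
  using measurable_component_singleton[of k "{..<n}" "\<lambda>_. borel :: complex measure"] by simp

text \<open>The event is homogeneous in \<open>w\<close>, so the bound can later be applied with a
  random second vector without first showing that this vector has norm one.\<close>

lemma uniform_sphere_tail:
  assumes t: "t > 0"
  shows "emeasure (uniform_sphere n)
      {u \<in> space (uniform_sphere n). t * (coord_norm n w)\<^sup>2 < (cmod (coord_dot n u w))\<^sup>2}
      \<le> ennreal (4 * exp (- (real n * t / 2)))"
    (is "emeasure _ ?S \<le> _")
proof -
  let ?g = "\<lambda>z. \<lambda>k\<in>{..<n}. z k / complex_of_real (coord_norm n z)"
  let ?P = "lborel_prod n" and ?U = "unit_ball n"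
  \<comment> \<open>The event moved back to the ball: the part of a cone lying in the ball, so that
    cap volumes apply.\<close>
  define V where "V = ?U \<inter> (?g -` ?S \<inter> space ?P)"
  have S: "?S \<in> sets (Pi\<^sub>M {..<n} (\<lambda>_. borel))"
    unfolding space_uniform_sphere by measurable
  have pre: "?g -` ?S \<inter> space ?P \<in> sets ?P"
    using normalise_measurable S by (rule measurable_sets)
  have "emeasure (uniform_sphere n) ?S = emeasure ?P V / emeasure ?P ?U"
    using S pre unfolding uniform_sphere_altdef V_def
    by (subst emeasure_distr) (simp_all add: space_uniform_sphere)
  also have "\<dots> \<le> ennreal (4 * exp (- (real n * t / 2)))"
  \<comment> \<open>In the first case Cauchy-Schwarz makes the event empty. In the second,
    \<open>t <= 1\<close> gives \<open>a^2 = t/2 <= 1/2\<close>, as the cap estimate requires, and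
    \<open>w\<close> can be normalised.\<close>
  proof (cases "coord_norm n w = 0 \<or> t > 1")
    case True
    have "V = {}"
    proof (rule ccontr)
      assume "V \<noteq> {}"
      then obtain z where z: "t * (coord_norm n w)\<^sup>2 < (cmod (coord_dot n (?g z) w))\<^sup>2"
        by (auto simp: V_def)
      \<comment> \<open>An inequality rather than an equality, because the origin is sent to 0 by
        division by zero.\<close>
      have "coord_norm n (?g z) \<le> 1"
      proof -
        have "coord_norm n (?g z) = coord_norm n (\<lambda>k. (1 / complex_of_real (coord_norm n z)) * z k)"
          by (rule coord_norm_cong) simp
        also have "\<dots> = cmod (1 / complex_of_real (coord_norm n z)) * coord_norm n z"
          by (rule coord_norm_scale)
        also have "\<dots> \<le> 1" by (simp add: norm_divide coord_norm_nonneg)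
        finally show ?thesis .
      qed
      then have "(coord_norm n (?g z))\<^sup>2 * (coord_norm n w)\<^sup>2 \<le> 1 * (coord_norm n w)\<^sup>2"
        by (intro mult_right_mono) (auto simp: coord_norm_nonneg power_le_one)
      with coord_dot_Cauchy_Schwarz[of n "?g z" w] z
      have "t * (coord_norm n w)\<^sup>2 < (coord_norm n w)\<^sup>2" by linarith
      then show False using True
        by (auto simp: mult_less_cancel_right2)
    qed
    then show ?thesis by simp
  next
    case False
    define w' where "w' = (\<lambda>k. complex_of_real (1 / coord_norm n w) * w k)"
    define a where "a = sqrt (t / 2)"
    have a: "0 \<le> a" "a\<^sup>2 = t / 2" using t by (auto simp: a_def)
    have w0: "coord_norm n w > 0" using False coord_norm_nonneg[of n w] by simp
    define cap where "cap = (\<lambda>c. {z \<in> ?U. a * coord_norm n z \<le> Re (coord_dot n z (\<lambda>k. c * w' k))})"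
    have unit: "coord_norm n (\<lambda>k. c * w' k) = 1" if "cmod c = 1" for c
      using w0 that by (simp add: w'_def coord_norm_scale norm_divide del: of_real_divide)
    have cap_le: "emeasure ?P (cap c) \<le> ennreal ((1 - t / 2) ^ n) * emeasure ?P ?U" if "cmod c = 1" for c
      unfolding cap_def a(2)[symmetric]
      using a False by (intro emeasure_cap_le unit that) auto
    have cap_meas [measurable]: "cap c \<in> sets ?P" for c
    proof -
      have "(\<lambda>z. coord_dot n z (\<lambda>k. c * w' k)) \<in> borel_measurable ?P"
        by measurable
      then have [measurable]: "(\<lambda>z. Re (coord_dot n z (\<lambda>k. c * w' k))) \<in> borel_measurable ?P"
        by (rule measurable_compose) (intro borel_measurable_continuous_onI continuous_intros)
      have "cap c = ?U \<inter> {z \<in> space ?P. a * coord_norm n z \<le> Re (coord_dot n z (\<lambda>k. c * w' k))}"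
        by (auto simp: cap_def unit_ball_def)
      then show ?thesis by simp
    qed
    \<comment> \<open>The inner product is conjugate-linear in its second argument, so the caps
      around \<open>w'\<close> rotated by 1, -1, -i, i test the real parts of \<open>h\<close>,
      \<open>-h\<close>, \<open>i h\<close>, \<open>-i h\<close>.\<close>
    have "V \<subseteq> cap 1 \<union> cap (-1) \<union> cap (-\<i>) \<union> cap \<i>"
    proof
      fix z assume z: "z \<in> V"
      define s where "s = coord_norm n z"
      define h where "h = coord_dot n z w'"
      have zU: "z \<in> ?U" and zS: "t * (coord_norm n w)\<^sup>2 < (cmod (coord_dot n (?g z) w))\<^sup>2"
        using z by (auto simp: V_def)
      have "coord_dot n (?g z) w = coord_dot n (\<lambda>k. (1 / complex_of_real s) * z k)
          (\<lambda>k. complex_of_real (coord_norm n w) * w' k)"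
        using w0 by (intro coord_dot_cong) (auto simp: w'_def s_def)
      also have "\<dots> = (1 / complex_of_real s) * complex_of_real (coord_norm n w) * h"
        by (simp only: coord_dot_scale h_def complex_cnj_complex_of_real)
      finally have eq: "(cmod (coord_dot n (?g z) w))\<^sup>2 = (coord_norm n w)\<^sup>2 * ((cmod h)\<^sup>2 / s\<^sup>2)"
        by (simp add: norm_mult norm_divide power_mult_distrib power_divide)
      have "t < (cmod h)\<^sup>2 / s\<^sup>2"
        using zS w0 unfolding eq by (subst (asm) mult.commute[of t], subst (asm) mult_less_cancel_left_pos) auto
      \<comment> \<open>At \<open>s = 0\<close> the quotient would be 0 by convention, contradicting
        \<open>t > 0\<close>.\<close>
      moreover from this t have "s \<noteq> 0" by auto
      ultimately have "t * s\<^sup>2 < (cmod h)\<^sup>2"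
        by (simp add: field_simps)
      then have "2 * (a * s)\<^sup>2 \<le> (cmod h)\<^sup>2" by (simp add: power_mult_distrib a)
      moreover have "0 \<le> a * s" using a by (simp add: s_def coord_norm_nonneg)
      ultimately have "a * s \<le> Re h \<or> a * s \<le> Re (- h) \<or> a * s \<le> Re (\<i> * h) \<or> a * s \<le> Re (- \<i> * h)"
        by (rule Re_or_Im_ge)
      moreover have scale: "coord_dot n z (\<lambda>k. c * w' k) = cnj c * h" for c
        using coord_dot_scale[of n 1 z c w'] by (simp add: h_def)
      ultimately show "z \<in> cap 1 \<union> cap (-1) \<union> cap (-\<i>) \<union> cap \<i>"
        using zU unfolding cap_def scale Un_iff mem_Collect_eq s_def[symmetric] by simp
    qed
    then have "emeasure ?P V \<le> emeasure ?P (cap 1 \<union> cap (-1) \<union> cap (-\<i>) \<union> cap \<i>)"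
      by (intro emeasure_mono) auto
    also have "\<dots> \<le> emeasure ?P (cap 1) + emeasure ?P (cap (-1)) + emeasure ?P (cap (-\<i>)) + emeasure ?P (cap \<i>)"
      by (intro order_trans[OF emeasure_subadditive] add_mono) auto
    also have "\<dots> \<le> ennreal ((1 - t / 2) ^ n) * emeasure ?P ?U + ennreal ((1 - t / 2) ^ n) * emeasure ?P ?U +
        ennreal ((1 - t / 2) ^ n) * emeasure ?P ?U + ennreal ((1 - t / 2) ^ n) * emeasure ?P ?U"
      by (intro add_mono cap_le) auto
    also have "\<dots> = ennreal (4 * (1 - t / 2) ^ n) * emeasure ?P ?U"
    proof -
      have "c + c + c + c = 4 * c" for c :: ennreal
      proof -
        have "4 * c = (1 + 1 + 1 + 1) * c" by simp
        then show ?thesis by (simp only: distrib_right mult_1)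
      qed
      then show ?thesis using False by (simp add: ennreal_mult mult.assoc)
    qed
    finally have "emeasure ?P V \<le> ennreal (4 * (1 - t / 2) ^ n) * emeasure ?P ?U" .
    then have "emeasure ?P V / emeasure ?P ?U \<le> ennreal (4 * (1 - t / 2) ^ n) * emeasure ?P ?U / emeasure ?P ?U"
      by (rule divide_right_mono_ennreal)
    also have "\<dots> = ennreal (4 * (1 - t / 2) ^ n)"
      using emeasure_unit_ball_pos[of n] emeasure_unit_ball_finite[of n]
      by (intro mult_divide_eq_ennreal) auto
    also have "\<dots> \<le> ennreal (4 * exp (- (real n * t / 2)))"
    proof -
      have "(1 - t / 2) ^ n \<le> exp (- (t / 2)) ^ n"
        using False exp_ge_add_one_self[of "- (t / 2)"] by (intro power_mono) auto
      also have "\<dots> = exp (- (real n * t / 2))"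
        by (simp add: exp_of_nat_mult[symmetric])
      finally show ?thesis by (intro ennreal_leI) simp
    qed
    finally show ?thesis .
  qed
  finally show ?thesis .
qed

text \<open>A union bound over ordered pairs of distinct indices, at most \<open>m^2\<close> of
  them, each violating its overlap bound with probability at most the sphere tail.\<close>

lemma sphere_product_pairs:
  fixes m n :: nat and t :: real
  assumes t: "t > 0"
  defines "N \<equiv> Pi\<^sub>M {..<m} (\<lambda>_. uniform_sphere n)"
  defines "A \<equiv> {x \<in> space N. \<forall>i<m. \<forall>j<m. i \<noteq> j \<longrightarrow>
     (cmod (coord_dot n (x i) (x j)))\<^sup>2 \<le> t * (coord_norm n (x j))\<^sup>2}"
  shows "A \<in> sets N" "measure N A \<ge> 1 - (real m)\<^sup>2 * (4 * exp (- (real n * t / 2)))"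
proof -
  let ?q = "4 * exp (- (real n * t / 2))"
  interpret U: prob_space "uniform_sphere n" by (rule prob_space_uniform_sphere)
  interpret product_prob_space "\<lambda>_::nat. uniform_sphere n" "{..<m}" by unfold_locales
  interpret N: prob_space N unfolding N_def by unfold_locales
  have comp [measurable]: "(\<lambda>x. x i k) \<in> borel_measurable (Pi\<^sub>M I (\<lambda>_. uniform_sphere n))"
    if "i \<in> I" "k < n" for i k and I :: "nat set"
  proof -
    have "(\<lambda>x. x i) \<in> measurable (Pi\<^sub>M I (\<lambda>_. uniform_sphere n)) (Pi\<^sub>M {..<n} (\<lambda>_. borel))"
      using that measurable_component_singleton[of i I "\<lambda>_. uniform_sphere n"]
      by (simp cong: measurable_cong_sets add: sets_uniform_sphere)
    from measurable_compose[OF this sphere_component_measurable[OF that(2)]] show ?thesis .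
  qed
  define bad where "bad = (\<lambda>(i, j). {x \<in> space N. t * (coord_norm n (x j))\<^sup>2 < (cmod (coord_dot n (x i) (x j)))\<^sup>2})"
  define J where "J = {(i, j). i < m \<and> j < m \<and> i \<noteq> j}"
  have J: "J \<subseteq> {..<m} \<times> {..<m}" "finite J"
    by (auto simp: J_def intro: finite_subset[of _ "{..<m} \<times> {..<m}"])
  have bad_sets: "bad p \<in> sets N" if "p \<in> J" for p
  proof -
    have "i < m \<Longrightarrow> j < m \<Longrightarrow> bad (i, j) \<in> sets N" for i j
      unfolding bad_def N_def by simp measurable
    with that show ?thesis by (auto simp: J_def)
  qed
  have bad_le: "emeasure N (bad p) \<le> ennreal ?q" if p: "p \<in> J" for p
  proof -
    obtain i j where ij: "p = (i, j)" "i < m" "j < m" "i \<noteq> j" using p by (auto simp: J_def)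
    define I where "I = {..<m} - {i}"
    have I: "insert i I = {..<m}" "finite I" "i \<notin> I" using ij by (auto simp: I_def)
    have "emeasure N (bad p) = (\<integral>\<^sup>+ x. indicator (bad p) x \<partial>N)"
      using bad_sets[OF p] by simp
    \<comment> \<open>Fubini integrates out coordinate \<open>i\<close> with all others frozen. As
      \<open>j\<close> differs from \<open>i\<close>, the vector \<open>x j\<close> stays fixed and
      serves as \<open>w\<close> in the tail bound.\<close>
    also have "\<dots> = (\<integral>\<^sup>+ x. (\<integral>\<^sup>+ u. indicator (bad p) (x(i := u)) \<partial>uniform_sphere n)
        \<partial>Pi\<^sub>M I (\<lambda>_. uniform_sphere n))"
      using product_nn_integral_insert[OF I(2,3), of "indicator (bad p)"] bad_sets[OF p]
      unfolding I(1) N_def by simp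
    also have "\<dots> \<le> (\<integral>\<^sup>+ x. ennreal ?q \<partial>Pi\<^sub>M I (\<lambda>_. uniform_sphere n))"
    proof (rule nn_integral_mono)
      fix x
      let ?S = "{u \<in> space (uniform_sphere n). t * (coord_norm n (x j))\<^sup>2 < (cmod (coord_dot n u (x j)))\<^sup>2}"
      have S: "?S \<in> sets (uniform_sphere n)" by measurable
      have "(\<integral>\<^sup>+ u. indicator (bad p) (x(i := u)) \<partial>uniform_sphere n)
          \<le> (\<integral>\<^sup>+ u. indicator ?S u \<partial>uniform_sphere n)"
        by (intro nn_integral_mono) (use ij in \<open>auto simp: bad_def split: split_indicator\<close>)
      also have "\<dots> \<le> ennreal ?q"
        using S uniform_sphere_tail[OF t, of n "x j"] by simp
      finally show "(\<integral>\<^sup>+ u. indicator (bad p) (x(i := u)) \<partial>uniform_sphere n) \<le> ennreal ?q" .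
    qed
    also have "\<dots> = ennreal ?q"
      using prob_space.emeasure_space_1[OF prob_space_PiM[of I "\<lambda>_. uniform_sphere n"]]
      by (simp add: prob_space_uniform_sphere)
    finally show ?thesis .
  qed
  have A_eq: "A = space N - (\<Union>p\<in>J. bad p)"
    by (auto simp: A_def bad_def J_def not_less) (metis leD)
  show "A \<in> sets N" unfolding A_eq using bad_sets J by auto
  have "measure N (\<Union>p\<in>J. bad p) \<le> (\<Sum>p\<in>J. measure N (bad p))"
    using bad_sets J by (intro N.finite_measure_subadditive_finite) auto
  also have "\<dots> \<le> (\<Sum>p\<in>J. ?q)"
    using bad_le by (intro sum_mono) (simp add: N.emeasure_eq_measure)
  also have "\<dots> = real (card J) * ?q" by simp
  also have "\<dots> \<le> (real m)\<^sup>2 * ?q"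
  proof (rule mult_right_mono)
    have "card J \<le> m * m" using card_mono[OF _ J(1)] by simp
    then have "real (card J) \<le> real (m * m)" by (rule of_nat_mono)
    then show "real (card J) \<le> (real m)\<^sup>2" by (simp add: power2_eq_square)
  qed simp
  finally show "measure N A \<ge> 1 - (real m)\<^sup>2 * ?q"
    unfolding A_eq using bad_sets J by (subst N.prob_compl) auto
qed

subsection \<open>The spectrum of Hermitian matrices\<close>

lemma cscalar_prod_sum:
  "u \<in> carrier_vec d \<Longrightarrow> w \<in> carrier_vec d \<Longrightarrow> u \<bullet>c w = (\<Sum>r<d. u $ r * cnj (w $ r))"
  by (simp add: scalar_prod_def lessThan_atLeast0)

lemma cnj_cscalar_prod:
  fixes u w :: "complex vec"
  shows "u \<in> carrier_vec d \<Longrightarrow> w \<in> carrier_vec d \<Longrightarrow> cnj (u \<bullet>c w) = w \<bullet>c u"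
  by (simp add: cscalar_prod_sum mult.commute)

lemma mult_mat_vec_nth:
  "A \<in> carrier_mat n d \<Longrightarrow> v \<in> carrier_vec d \<Longrightarrow> r < n \<Longrightarrow> (A *\<^sub>v v) $ r = (\<Sum>s<d. A $$ (r, s) * v $ s)"
  by (simp add: scalar_prod_def lessThan_atLeast0)

lemma mult_mat_nth:
  "A \<in> carrier_mat n d \<Longrightarrow> B \<in> carrier_mat d k \<Longrightarrow> r < n \<Longrightarrow> c < k \<Longrightarrow>
     (A * B) $$ (r, c) = (\<Sum>s<d. A $$ (r, s) * B $$ (s, c))"
  by (simp add: scalar_prod_def lessThan_atLeast0)

lemma nonzero_vec_nth:
  assumes "v \<in> carrier_vec m" "v \<noteq> 0\<^sub>v m"
  shows "\<exists>k<m. v $ k \<noteq> 0"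
proof (rule ccontr)
  assume "\<not> ?thesis"
  then have "v = 0\<^sub>v m" using assms(1) by (intro eq_vecI) auto
  with assms(2) show False by contradiction
qed

text \<open>Read the eigenvalue equation in the row where the eigenvector has its entry of largest
  modulus, and divide by that modulus.\<close>

lemma Gershgorin:
  fixes A :: "complex mat"
  assumes A: "A \<in> carrier_mat m m" and ev: "eigenvalue A z"
  obtains i where "i < m" "cmod (z - A $$ (i, i)) \<le> (\<Sum>j\<in>{..<m} - {i}. cmod (A $$ (i, j)))"
proof -
  obtain v where v: "v \<in> carrier_vec m" "v \<noteq> 0\<^sub>v m" "A *\<^sub>v v = z \<cdot>\<^sub>v v"
    using ev A by (auto simp: eigenvalue_def eigenvector_def)
  obtain k where k: "k < m" "v $ k \<noteq> 0"
    using nonzero_vec_nth[OF v(1,2)] by blast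
  have "Max ((\<lambda>i. cmod (v $ i)) ` {..<m}) \<in> (\<lambda>i. cmod (v $ i)) ` {..<m}"
    using k by (intro Max_in) auto
  then obtain i where i: "i < m" "cmod (v $ i) = Max ((\<lambda>i. cmod (v $ i)) ` {..<m})" by auto
  have max: "cmod (v $ j) \<le> cmod (v $ i)" if "j < m" for j
    unfolding i(2) using that by (intro Max_ge) auto
  have pos: "cmod (v $ i) > 0"
    using max[OF k(1)] k(2) by (meson less_le_trans zero_less_norm_iff)
  have "z * v $ i = (\<Sum>j<m. A $$ (i, j) * v $ j)"
    using mult_mat_vec_nth[OF A v(1) i(1)] v i(1) by simp
  also have "\<dots> = A $$ (i, i) * v $ i + (\<Sum>j\<in>{..<m} - {i}. A $$ (i, j) * v $ j)"
    using i(1) by (simp add: sum.remove)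
  finally have "(z - A $$ (i, i)) * v $ i = (\<Sum>j\<in>{..<m} - {i}. A $$ (i, j) * v $ j)"
    by (simp add: algebra_simps)
  then have "cmod (z - A $$ (i, i)) * cmod (v $ i) = cmod (\<Sum>j\<in>{..<m} - {i}. A $$ (i, j) * v $ j)"
    by (metis norm_mult)
  also have "\<dots> \<le> (\<Sum>j\<in>{..<m} - {i}. cmod (A $$ (i, j)) * cmod (v $ i))"
    using max by (intro sum_norm_le) (auto simp: norm_mult intro!: mult_left_mono)
  also have "\<dots> = (\<Sum>j\<in>{..<m} - {i}. cmod (A $$ (i, j))) * cmod (v $ i)"
    by (simp add: sum_distrib_right)
  finally show ?thesis using that i(1) pos by simp
qed

text \<open>The quadratic form at an eigenvector is \<open>z\<close> times the positive squared
  norm, and Hermitian symmetry makes it equal to its own conjugate.\<close>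

lemma hermitian_eigenvalue_Reals:
  fixes A :: "complex mat"
  assumes A: "A \<in> carrier_mat m m" and H: "\<And>i j. i < m \<Longrightarrow> j < m \<Longrightarrow> cnj (A $$ (i, j)) = A $$ (j, i)"
    and ev: "eigenvalue A z"
  shows "z \<in> \<real>"
proof -
  obtain v where v: "v \<in> carrier_vec m" "v \<noteq> 0\<^sub>v m" "A *\<^sub>v v = z \<cdot>\<^sub>v v"
    using ev A by (auto simp: eigenvalue_def eigenvector_def)
  have row: "z * v $ i = (\<Sum>j<m. A $$ (i, j) * v $ j)" if "i < m" for i
    using mult_mat_vec_nth[OF A v(1) that] v that by simp
  define q where "q = (\<Sum>i<m. \<Sum>j<m. A $$ (i, j) * v $ j * cnj (v $ i))"
  define s where "s = (\<Sum>i<m. (cmod (v $ i))\<^sup>2)"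
  have "q = (\<Sum>i<m. z * v $ i * cnj (v $ i))"
    unfolding q_def by (simp add: row sum_distrib_right)
  also have "\<dots> = z * complex_of_real s"
    by (simp add: s_def sum_distrib_left mult.assoc complex_norm_square[symmetric] flip: of_real_power)
  finally have q: "q = z * complex_of_real s" .
  have "cnj q = (\<Sum>i<m. \<Sum>j<m. A $$ (j, i) * v $ i * cnj (v $ j))"
    unfolding q_def by (simp add: H mult_ac)
  also have "\<dots> = q" unfolding q_def by (rule sum.swap)
  finally have "cnj q = q" .
  obtain k where "k < m" "v $ k \<noteq> 0"
    using nonzero_vec_nth[OF v(1,2)] by blast
  then have "s \<noteq> 0" unfolding s_def by (auto simp: sum_nonneg_eq_0_iff)
  with \<open>cnj q = q\<close> have "cnj z = z" unfolding q by simp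
  then show ?thesis by (simp add: complex_is_Real_iff complex_eq_iff)
qed

text \<open>Being Hermitian excludes the junk value of \<^const>\<open>Min\<close> on the empty set.\<close>

lemma min_eigenvalue_ge:
  assumes A: "A \<in> carrier_mat m m" and m: "m > 0"
    and H: "\<And>i j. i < m \<Longrightarrow> j < m \<Longrightarrow> cnj (A $$ (i, j)) = A $$ (j, i)"
    and ge: "\<And>x. eigenvalue A (complex_of_real x) \<Longrightarrow> b \<le> x"
  shows "b \<le> min_eigenvalue A"
proof -
  let ?S = "{x. eigenvalue A (complex_of_real x)}"
  have "finite (complex_of_real ` ?S)"
    by (rule finite_subset[OF _ card_finite_spectrum(1)[OF A]]) (auto simp: spectrum_def)
  then have "finite ?S" by (rule finite_imageD) (auto simp: inj_on_def)
  moreover obtain z where z: "eigenvalue A z"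
    using spectrum_non_empty[OF A m] by (auto simp: spectrum_def)
  then have "z \<in> \<real>" using A H by (intro hermitian_eigenvalue_Reals)
  with z have "?S \<noteq> {}" by (auto elim!: Reals_cases)
  ultimately show ?thesis unfolding min_eigenvalue_def using ge by simp
qed

subsection \<open>The kernel at a global minimum\<close>

text \<open>Orthonormality says that the conjugate transpose is a left inverse of the square matrix
  with columns \<open>g k\<close>; a left inverse of a square matrix is also a right
  inverse.\<close>

lemma orthonormal_basis_complete:
  assumes g: "orthonormal_family d d g" and rc: "r < d" "c < d"
  shows "(\<Sum>k<d. g k $ r * cnj (g k $ c)) = (if r = c then 1 else 0)"
proof -
  define U where "U = mat d d (\<lambda>(r, k). g k $ r)"
  define V where "V = mat d d (\<lambda>(k, r). cnj (g k $ r))"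
  have UV: "U \<in> carrier_mat d d" "V \<in> carrier_mat d d" by (auto simp: U_def V_def)
  have "V * U = 1\<^sub>m d"
  proof (rule eq_matI)
    fix k l assume kl: "k < dim_row (1\<^sub>m d)" "l < dim_col (1\<^sub>m d :: complex mat)"
    then have "(V * U) $$ (k, l) = g l \<bullet>c g k"
      using g by (subst mult_mat_nth[OF UV(2,1)])
        (auto simp: orthonormal_family_def cscalar_prod_sum[of _ d] U_def V_def mult.commute)
    also have "\<dots> = (1\<^sub>m d :: complex mat) $$ (k, l)"
      using g kl by (auto simp: orthonormal_family_def)
    finally show "(V * U) $$ (k, l) = (1\<^sub>m d :: complex mat) $$ (k, l)" .
  qed (use UV in auto)
  then have "U * V = 1\<^sub>m d" by (rule mat_mult_left_right_inverse[OF UV(2,1)])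
  then have "(U * V) $$ (r, c) = (1\<^sub>m d :: complex mat) $$ (r, c)" by simp
  then show ?thesis
    using rc by (subst (asm) mult_mat_nth[OF UV]) (auto simp: U_def V_def)
qed

text \<open>Since \<open>d\<close> is even, listing \<open>e\<close> and then \<open>f\<close> gives
  exactly \<open>d\<close> orthonormal vectors, hence a basis: the two projections add up to the
  identity.\<close>

lemma half_split_complete:
  assumes hs: "half_split d e f" and d: "even d" and rc: "r < d" "c < d"
  shows "(\<Sum>k<d div 2. e k $ r * cnj (e k $ c)) + (\<Sum>k<d div 2. f k $ r * cnj (f k $ c))
     = (if r = c then 1 else 0)"
proof -
  define n where "n = d div 2"
  have dn: "d = n + n" using d by (auto simp: n_def)
  define g where "g = (\<lambda>k. if k < n then e k else f (k - n))"
  have car: "e k \<in> carrier_vec d" "f k \<in> carrier_vec d" if "k < n" for k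
    using hs that by (auto simp: half_split_def orthonormal_family_def n_def)
  have ef: "e k \<bullet>c f l = 0" if "k < n" "l < n" for k l
    using hs that by (auto simp: half_split_def n_def)
  then have fe: "f l \<bullet>c e k = 0" if "k < n" "l < n" for k l
    using that cnj_cscalar_prod[OF car(1)[OF that(1)] car(2)[OF that(2)]] by simp
  have "orthonormal_family d d g"
    using hs ef fe unfolding half_split_def orthonormal_family_def n_def[symmetric] g_def
    by (auto simp: dn)
  from orthonormal_basis_complete[OF this rc]
  have "(\<Sum>k<n + n. g k $ r * cnj (g k $ c)) = (if r = c then 1 else 0)" by (simp flip: dn)
  moreover have "(\<Sum>k<n + n. g k $ r * cnj (g k $ c))
      = (\<Sum>k<n. g k $ r * cnj (g k $ c)) + (\<Sum>k<n. g (n + k) $ r * cnj (g (n + k) $ c))"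
    using sum.atLeastLessThan_concat[of 0 n "n + n" "\<lambda>k. g k $ r * cnj (g k $ c)"]
      sum.shift_bounds_nat_ivl[of "\<lambda>k. g k $ r * cnj (g k $ c)" 0 n n]
    by (simp add: lessThan_atLeast0 add.commute)
  ultimately show ?thesis by (simp add: g_def n_def)
qed

text \<open>The sesquilinear form of the orthogonal projection onto the span of \<open>e\<close>,
  written through coefficients so that no matrix appears.\<close>

definition proj_form :: "nat \<Rightarrow> (nat \<Rightarrow> complex vec) \<Rightarrow> complex vec \<Rightarrow> complex vec \<Rightarrow> complex" where
  "proj_form n e u w = (\<Sum>k<n. (u \<bullet>c e k) * cnj (w \<bullet>c e k))"

lemma proj_form_sum:
  assumes "u \<in> carrier_vec d" "w \<in> carrier_vec d" "\<And>k. k < n \<Longrightarrow> e k \<in> carrier_vec d"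
  shows "proj_form n e u w = (\<Sum>r<d. \<Sum>s<d. (\<Sum>k<n. e k $ s * cnj (e k $ r)) * u $ r * cnj (w $ s))"
proof -
  have "proj_form n e u w =
      (\<Sum>k<n. \<Sum>r<d. \<Sum>s<d. e k $ s * cnj (e k $ r) * u $ r * cnj (w $ s))"
    unfolding proj_form_def using assms
    by (intro sum.cong refl) (simp add: cscalar_prod_sum[of _ d] sum_product mult_ac)
  also have "\<dots> = (\<Sum>r<d. \<Sum>k<n. \<Sum>s<d. e k $ s * cnj (e k $ r) * u $ r * cnj (w $ s))"
    by (rule sum.swap)
  also have "\<dots> = (\<Sum>r<d. \<Sum>s<d. \<Sum>k<n. e k $ s * cnj (e k $ r) * u $ r * cnj (w $ s))"
    by (intro sum.cong refl sum.swap)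
  finally show ?thesis by (simp add: sum_distrib_right)
qed

lemma proj_onto_carrier: "proj_onto d n e \<in> carrier_mat d d"
  by (simp add: proj_onto_def)

lemma proj_onto_nth:
  "r < d \<Longrightarrow> c < d \<Longrightarrow> proj_onto d n e $$ (r, c) = (\<Sum>k<n. e k $ r * cnj (e k $ c))"
  by (simp add: proj_onto_def ketbra_def)

lemma proj_onto_cscalar_prod:
  assumes "u \<in> carrier_vec d" "w \<in> carrier_vec d" "\<And>k. k < n \<Longrightarrow> e k \<in> carrier_vec d"
  shows "(proj_onto d n e *\<^sub>v u) \<bullet>c w = proj_form n e u w"
proof -
  have "proj_onto d n e *\<^sub>v u \<in> carrier_vec d"
    using proj_onto_carrier assms(1) by (rule mult_mat_vec_carrier)
  then have "(proj_onto d n e *\<^sub>v u) \<bullet>c w = (\<Sum>s<d. (\<Sum>r<d. proj_onto d n e $$ (s, r) * u $ r) * cnj (w $ s))"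
    using assms
    by (subst cscalar_prod_sum[of _ d])
      (auto intro!: sum.cong simp: mult_mat_vec_nth[OF proj_onto_carrier] simp del: index_mult_mat_vec)
  also have "\<dots> = (\<Sum>s<d. \<Sum>r<d. (\<Sum>k<n. e k $ s * cnj (e k $ r)) * u $ r * cnj (w $ s))"
    by (simp add: sum_distrib_right proj_onto_nth)
  also have "\<dots> = proj_form n e u w"
    by (subst proj_form_sum[of u d w n e]) (use assms in \<open>auto intro: sum.swap\<close>)
  finally show ?thesis .
qed

section \<open>Entries of the commutator kernel\<close>

lemma ketbra_carrier: "ketbra d v \<in> carrier_mat d d"
  by (simp add: ketbra_def)

text \<open>Multiplying \<open>v v^*\<close> by \<open>M\<close> on the right gives
  \<open>v (M v)^*\<close> because \<open>M\<close> is Hermitian, so the commutator is a difference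
  of two outer products.\<close>

lemma commutator_ketbra_nth:
  assumes M: "M \<in> carrier_mat d d" and H: "\<And>r c. r < d \<Longrightarrow> c < d \<Longrightarrow> cnj (M $$ (r, c)) = M $$ (c, r)"
    and v: "v \<in> carrier_vec d" and rc: "r < d" "c < d"
  shows "commutator M (ketbra d v) $$ (r, c) =
     (M *\<^sub>v v) $ r * cnj (v $ c) - v $ r * cnj ((M *\<^sub>v v) $ c)"
proof -
  have "(M * ketbra d v) $$ (r, c) = (M *\<^sub>v v) $ r * cnj (v $ c)"
    using rc by (subst mult_mat_nth[OF M ketbra_carrier])
      (simp_all add: mult_mat_vec_nth[OF M v] ketbra_def sum_distrib_right sum_distrib_left mult_ac del: index_mult_mat_vec)
  moreover have "(ketbra d v * M) $$ (r, c) = v $ r * cnj ((M *\<^sub>v v) $ c)"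
    using rc by (subst mult_mat_nth[OF ketbra_carrier M])
      (simp_all add: mult_mat_vec_nth[OF M v] ketbra_def sum_distrib_left H mult_ac del: index_mult_mat_vec)
  moreover have "commutator M (ketbra d v) $$ (r, c) = (M * ketbra d v) $$ (r, c) - (ketbra d v * M) $$ (r, c)"
    unfolding commutator_def using rc M
    by (intro index_minus_mat(1)) (auto simp: ketbra_def)
  ultimately show ?thesis by simp
qed

lemma K_asym_carrier: "K_asym d m M v \<in> carrier_mat m m"
  by (simp add: K_asym_def)

text \<open>Each commutator is a difference of two outer products, so the trace splits into four
  double sums, each factoring into two inner products. The two factors i supply the overall minus
  sign.\<close>

lemma K_asym_nth:
  assumes M: "M \<in> carrier_mat d d" and H: "\<And>r c. r < d \<Longrightarrow> c < d \<Longrightarrow> cnj (M $$ (r, c)) = M $$ (c, r)"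
    and v: "\<And>i. i < m \<Longrightarrow> v i \<in> carrier_vec d" and ij: "i < m" "j < m"
  defines "a \<equiv> \<lambda>i. M *\<^sub>v v i"
  shows "K_asym d m M v $$ (i, j) =
     (a i \<bullet>c a j) * (v j \<bullet>c v i) + (v i \<bullet>c v j) * (a j \<bullet>c a i)
     - (a i \<bullet>c v j) * (a j \<bullet>c v i) - (v i \<bullet>c a j) * (v j \<bullet>c a i)"
proof -
  let ?X = "\<lambda>i. commutator M (ketbra d (v i))"
  have X: "?X i \<in> carrier_mat d d" for i
    unfolding commutator_def using M ketbra_carrier
    by (meson minus_carrier_mat mult_carrier_mat)
  then have iX: "\<i> \<cdot>\<^sub>m ?X i \<in> carrier_mat d d" for i by simp
  have a: "a i \<in> carrier_vec d" "a j \<in> carrier_vec d" using M v ij by (auto simp: a_def)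
  note v' = v[OF ij(1)] v[OF ij(2)]
  have "K_asym d m M v $$ (i, j) = (\<Sum>r<d. ((\<i> \<cdot>\<^sub>m ?X i) * (\<i> \<cdot>\<^sub>m ?X j)) $$ (r, r))"
    using ij M by (simp add: K_asym_def mat_trace_def commutator_def carrier_matD[OF ketbra_carrier])
  also have "\<dots> = (\<Sum>r<d. \<Sum>s<d. (\<i> \<cdot>\<^sub>m ?X i) $$ (r, s) * (\<i> \<cdot>\<^sub>m ?X j) $$ (s, r))"
    by (intro sum.cong refl mult_mat_nth[OF iX iX]) auto
  also have "\<dots> = (\<Sum>r<d. \<Sum>s<d. - (?X i $$ (r, s) * ?X j $$ (s, r)))"
  proof (intro sum.cong refl)
    fix r s assume rs: "r \<in> {..<d}" "s \<in> {..<d}"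
    have "(\<i> \<cdot>\<^sub>m ?X i) $$ (r, s) = \<i> * ?X i $$ (r, s)" "(\<i> \<cdot>\<^sub>m ?X j) $$ (s, r) = \<i> * ?X j $$ (s, r)"
      using rs X[of i] X[of j] by (auto simp: carrier_matD intro!: index_smult_mat(1))
    then show "(\<i> \<cdot>\<^sub>m ?X i) $$ (r, s) * (\<i> \<cdot>\<^sub>m ?X j) $$ (s, r) = - (?X i $$ (r, s) * ?X j $$ (s, r))"
      by (simp add: algebra_simps)
  qed
  also have "\<dots> = (\<Sum>r<d. \<Sum>s<d. (a i $ r * cnj (a j $ r)) * (v j $ s * cnj (v i $ s))
       + (v i $ r * cnj (v j $ r)) * (a j $ s * cnj (a i $ s))
       - (a i $ r * cnj (v j $ r)) * (a j $ s * cnj (v i $ s))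
       - (v i $ r * cnj (a j $ r)) * (v j $ s * cnj (a i $ s)))"
    using v' by (intro sum.cong refl)
      (simp add: commutator_ketbra_nth[OF M H] a_def algebra_simps del: index_mult_mat_vec)
  also have "\<dots> = (a i \<bullet>c a j) * (v j \<bullet>c v i) + (v i \<bullet>c v j) * (a j \<bullet>c a i)
     - (a i \<bullet>c v j) * (a j \<bullet>c v i) - (v i \<bullet>c a j) * (v j \<bullet>c a i)"
    using v' a by (simp only: cscalar_prod_sum[of _ d] sum_product sum.distrib sum_subtractf)
  finally show ?thesis .
qed

lemma coord_dot_self: "coord_dot n z z = complex_of_real ((coord_norm n z)\<^sup>2)"
  by (simp add: coord_dot_def coord_norm_sq complex_norm_square[symmetric] flip: of_real_power)

section \<open>The measurement and its kernel for a fixed splitting\<close>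

context
  fixes d :: nat and e f :: "nat \<Rightarrow> complex vec" and \<gamma> :: real
  assumes hs: "half_split d e f" and d: "even d"
begin

lemma half_split_carrier:
  assumes "k < d div 2"
  shows "e k \<in> carrier_vec d" "f k \<in> carrier_vec d"
  using hs assms by (auto simp: half_split_def orthonormal_family_def)

lemma half_split_cscalar_prod:
  assumes "k < d div 2" "l < d div 2"
  shows "e k \<bullet>c e l = (if k = l then 1 else 0)" "f k \<bullet>c f l = (if k = l then 1 else 0)"
    "e k \<bullet>c f l = 0" "f l \<bullet>c e k = 0"
proof -
  show ef: "e k \<bullet>c f l = 0" using hs assms by (simp add: half_split_def)
  show "f l \<bullet>c e k = 0"
    using cnj_cscalar_prod[OF half_split_carrier(1)[OF assms(1)] half_split_carrier(2)[OF assms(2)]]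
    by (simp add: ef)
qed (use hs assms in \<open>auto simp: half_split_def orthonormal_family_def\<close>)

lemma proj_form_complete:
  assumes "u \<in> carrier_vec d" "w \<in> carrier_vec d"
  shows "proj_form (d div 2) e u w + proj_form (d div 2) f u w = u \<bullet>c w"
proof -
  have "proj_form (d div 2) e u w + proj_form (d div 2) f u w = (\<Sum>r<d. \<Sum>s<d.
      ((\<Sum>k<d div 2. e k $ s * cnj (e k $ r)) + (\<Sum>k<d div 2. f k $ s * cnj (f k $ r)))
        * u $ r * cnj (w $ s))"
    using assms half_split_carrier
    by (simp add: proj_form_sum[of u d w] sum.distrib distrib_right)
  also have "\<dots> = (\<Sum>r<d. \<Sum>s<d. if s = r then u $ r * cnj (w $ s) else 0)"
    by (intro sum.cong refl) (simp add: half_split_complete[OF hs d])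
  also have "\<dots> = u \<bullet>c w"
    using assms by (simp add: cscalar_prod_sum[of _ d])
  finally show ?thesis .
qed

lemma proj_form_basis:
  assumes "k < d div 2"
  shows "proj_form (d div 2) e u (e k) = u \<bullet>c e k" "proj_form (d div 2) f u (f k) = u \<bullet>c f k"
    "proj_form (d div 2) e u (f k) = 0" "proj_form (d div 2) f u (e k) = 0"
  using assms by (simp_all add: proj_form_def half_split_cscalar_prod if_distrib sum.delta cong: if_cong)

private abbreviation (input) "M \<equiv> measurement d \<gamma> e f"

lemma measurement_carrier: "M \<in> carrier_mat d d"
  unfolding measurement_def using proj_onto_carrier by (meson minus_carrier_mat smult_carrier_mat)

lemma measurement_nth:
  assumes "r < d" "c < d"
  shows "M $$ (r, c) = complex_of_real \<gamma> *
    (proj_onto d (d div 2) e $$ (r, c) - proj_onto d (d div 2) f $$ (r, c))"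
  using assms by (simp add: measurement_def proj_onto_def)

lemma measurement_hermitian: "r < d \<Longrightarrow> c < d \<Longrightarrow> cnj (M $$ (r, c)) = M $$ (c, r)"
  by (simp add: measurement_nth proj_onto_nth mult.commute)

lemma measurement_mult_carrier: "u \<in> carrier_vec d \<Longrightarrow> M *\<^sub>v u \<in> carrier_vec d"
  using measurement_carrier by (rule mult_mat_vec_carrier)

lemma measurement_form:
  assumes u: "u \<in> carrier_vec d" and w: "w \<in> carrier_vec d"
  shows "(M *\<^sub>v u) \<bullet>c w =
    complex_of_real \<gamma> * (proj_form (d div 2) e u w - proj_form (d div 2) f u w)"
proof -
  let ?P = "proj_onto d (d div 2) e *\<^sub>v u" and ?Q = "proj_onto d (d div 2) f *\<^sub>v u"
  have PQ: "?P \<in> carrier_vec d" "?Q \<in> carrier_vec d"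
    using proj_onto_carrier u by (auto intro: mult_mat_vec_carrier)
  have "(M *\<^sub>v u) $ r = complex_of_real \<gamma> * (?P $ r - ?Q $ r)" if "r < d" for r
    using that
    by (simp add: mult_mat_vec_nth[OF measurement_carrier u] mult_mat_vec_nth[OF proj_onto_carrier u]
        measurement_nth sum_distrib_left sum_subtractf algebra_simps del: index_mult_mat_vec)
  then have "(M *\<^sub>v u) \<bullet>c w = (\<Sum>r<d. complex_of_real \<gamma> * (?P $ r - ?Q $ r) * cnj (w $ r))"
    using measurement_mult_carrier[OF u] w
    by (simp add: cscalar_prod_sum[of _ d] del: index_mult_mat_vec)
  also have "\<dots> = complex_of_real \<gamma> * (?P \<bullet>c w - ?Q \<bullet>c w)"
    using PQ w
    by (simp add: cscalar_prod_sum[of _ d] sum_distrib_left sum_subtractf algebra_simps del: index_mult_mat_vec)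
  finally have "(M *\<^sub>v u) \<bullet>c w = complex_of_real \<gamma> * (?P \<bullet>c w - ?Q \<bullet>c w)" .
  then show ?thesis
    using u w half_split_carrier by (simp add: proj_onto_cscalar_prod)
qed

text \<open>\<open>M\<close> multiplies the \<open>e\<close>-coefficients by \<open>\<gamma>\<close>
  and the \<open>f\<close>-coefficients by \<open>-\<gamma>\<close>; in the product of two
  coefficients the sign cancels.\<close>

lemma measurement_isometry:
  assumes u: "u \<in> carrier_vec d" and w: "w \<in> carrier_vec d"
  shows "(M *\<^sub>v u) \<bullet>c (M *\<^sub>v w) = complex_of_real (\<gamma>\<^sup>2) * (u \<bullet>c w)"
proof -
  have "(M *\<^sub>v u) \<bullet>c e k = complex_of_real \<gamma> * (u \<bullet>c e k)"
    "(M *\<^sub>v u) \<bullet>c f k = - complex_of_real \<gamma> * (u \<bullet>c f k)"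
    if "u \<in> carrier_vec d" "k < d div 2" for k u
    using that by (simp_all add: measurement_form half_split_carrier proj_form_basis)
  then have "proj_form (d div 2) e (M *\<^sub>v u) (M *\<^sub>v w) = complex_of_real (\<gamma>\<^sup>2) * proj_form (d div 2) e u w"
    "proj_form (d div 2) f (M *\<^sub>v u) (M *\<^sub>v w) = complex_of_real (\<gamma>\<^sup>2) * proj_form (d div 2) f u w"
    using u w by (simp_all add: proj_form_def sum_distrib_left power2_eq_square mult_ac)
  then show ?thesis
    using proj_form_complete[OF measurement_mult_carrier[OF u] measurement_mult_carrier[OF w]]
      proj_form_complete[OF u w]
    by (simp add: distrib_left[symmetric])
qed

lemma from_coords_cscalar_prod:
  assumes "k < d div 2"
  shows "from_coords d (d div 2) e z \<bullet>c e k = z k"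
proof -
  have "from_coords d (d div 2) e z \<bullet>c e k = (\<Sum>r<d. (\<Sum>l<d div 2. z l * e l $ r) * cnj (e k $ r))"
    using half_split_carrier(1)[OF assms]
    by (subst cscalar_prod_sum[of _ d]) (auto simp: from_coords_def)
  also have "\<dots> = (\<Sum>l<d div 2. \<Sum>r<d. z l * (e l $ r * cnj (e k $ r)))"
    by (subst sum.swap) (simp add: sum_distrib_right mult.assoc)
  also have "\<dots> = (\<Sum>l<d div 2. z l * (e l \<bullet>c e k))"
    using half_split_carrier(1) assms by (simp add: cscalar_prod_sum[of _ d] sum_distrib_left)
  also have "\<dots> = (\<Sum>l<d div 2. if l = k then z l else 0)"
    using assms by (intro sum.cong refl) (simp add: half_split_cscalar_prod)
  also have "\<dots> = z k" using assms by simp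
  finally show ?thesis .
qed

lemma K_asym_hermitian:
  assumes v: "\<And>i. i < m \<Longrightarrow> v i \<in> carrier_vec d" and ij: "i < m" "j < m"
  shows "cnj (K_asym d m M v $$ (i, j)) = K_asym d m M v $$ (j, i)"
  using v[OF ij(1)] v[OF ij(2)] measurement_mult_carrier ij
  by (simp add: K_asym_nth[OF measurement_carrier measurement_hermitian v] cnj_cscalar_prod[of _ d] mult_ac)

text \<open>The deterministic half: once all pairwise overlaps are at most \<open>t\<close>, every
  Gershgorin radius is at most \<open>8 \<gamma>^2 m t\<close>, which is \<open>2 \<gamma>^2\<close>
  times \<open>4 m t\<close>.\<close>

lemma min_eigenvalue_K_asym:
  fixes y :: "nat \<Rightarrow> real" and x :: "nat \<Rightarrow> nat \<Rightarrow> complex"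
  assumes \<gamma>: "\<gamma> > 1" and m: "m > 0" and t: "t \<ge> 0"
    and y: "\<And>j. j < m \<Longrightarrow> y j = 1 \<or> y j = -1"
    and min: "global_min d m M y v"
    and dir: "\<And>j. j < m \<Longrightarrow> proj_onto d (d div 2) e *\<^sub>v v j =
      complex_of_real (sqrt (1 / 2 * (1 + y j / \<gamma>))) \<cdot>\<^sub>v from_coords d (d div 2) e (x j)"
    and small: "\<And>i j. i < m \<Longrightarrow> j < m \<Longrightarrow> i \<noteq> j \<Longrightarrow>
      (cmod (coord_dot (d div 2) (x i) (x j)))\<^sup>2 \<le> t * (coord_norm (d div 2) (x j))\<^sup>2"
  shows "2 * \<gamma>\<^sup>2 * (1 - 1 / \<gamma>\<^sup>2 - 4 * real m * t) \<le> min_eigenvalue (K_asym d m M v)"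
proof -
  let ?n = "d div 2"
  define s where "s = (\<lambda>j. sqrt (1 / 2 * (1 + y j / \<gamma>)))"
  have v: "v j \<in> carrier_vec d" if "j < m" for j
    using min that by (simp add: global_min_def orthonormal_family_def)
  have vv: "v i \<bullet>c v j = (if i = j then 1 else 0)" if "i < m" "j < m" for i j
    using min that by (simp add: global_min_def orthonormal_family_def)
  have Mvv: "(M *\<^sub>v v j) \<bullet>c v j = complex_of_real (y j)" if "j < m" for j
    using min that by (simp add: global_min_def)
  have s: "0 \<le> s j" "s j \<le> 1" "2 * (s j)\<^sup>2 = 1 + y j / \<gamma>" "1 + y j / \<gamma> > 0" if "j < m" for j
    using y[OF that] \<gamma> by (auto simp: s_def field_simps)
  have coord: "v j \<bullet>c e k = complex_of_real (s j) * x j k" if "j < m" "k < ?n" for j k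
  proof -
    have "v j \<bullet>c e k = (proj_onto d ?n e *\<^sub>v v j) \<bullet>c e k"
      using v that half_split_carrier by (simp add: proj_onto_cscalar_prod proj_form_basis)
    also have "\<dots> = complex_of_real (s j) * (from_coords d ?n e (x j) \<bullet>c e k)"
      unfolding dir[OF that(1)] s_def
      using half_split_carrier(1)[OF that(2)]
      by (intro smult_scalar_prod_distrib[of _ d]) (auto simp: from_coords_def)
    also have "\<dots> = complex_of_real (s j) * x j k"
      using that by (simp add: from_coords_cscalar_prod)
    finally show ?thesis .
  qed
  have pe: "proj_form ?n e (v i) (v j) = complex_of_real (s i * s j) * coord_dot ?n (x i) (x j)"
    if "i < m" "j < m" for i j
    using that by (simp add: proj_form_def coord coord_dot_def sum_distrib_left mult_ac)
  \<comment> \<open>By completeness the \<open>E\<^sub>-\<close>-part is \<open>\<langle>v\<^sub>i, v\<^sub>j\<rangle>\<close> minus the \<open>E\<^sub>+\<close>-part.\<close>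
  have Mv: "(M *\<^sub>v v i) \<bullet>c v j = complex_of_real \<gamma> *
      (2 * complex_of_real (s i * s j) * coord_dot ?n (x i) (x j) - (if i = j then 1 else 0))"
    if "i < m" "j < m" for i j
  proof -
    have "proj_form ?n f (v i) (v j) = (if i = j then 1 else 0) - proj_form ?n e (v i) (v j)"
      using proj_form_complete[OF v[OF that(1)] v[OF that(2)]] vv[OF that] by (simp add: algebra_simps)
    then show ?thesis using v that by (simp add: measurement_form pe)
  qed
  \<comment> \<open>The label condition itself forces unit norm, as
    \<open>1 + y j / \<gamma>\<close> is positive. Hence no almost-sure normalisation of the sample
    is needed.\<close>
  have norm_x: "(coord_norm ?n (x j))\<^sup>2 = 1" if "j < m" for j
  proof -
    have "complex_of_real (y j) = complex_of_real (\<gamma> * (2 * (s j)\<^sup>2 * (coord_norm ?n (x j))\<^sup>2 - 1))"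
      using Mv[OF that that] Mvv[OF that] by (simp add: coord_dot_self power2_eq_square)
    then have "y j = \<gamma> * ((1 + y j / \<gamma>) * (coord_norm ?n (x j))\<^sup>2 - 1)"
      using s(3)[OF that] by (simp only: of_real_eq_iff)
    moreover have "Z = 1 + Y / \<gamma>" if "Y = \<gamma> * (Z - 1)" for Y Z
      using that \<gamma> by simp
    ultimately have "(1 + y j / \<gamma>) * (coord_norm ?n (x j))\<^sup>2 = 1 + y j / \<gamma>"
      by blast
    then show ?thesis using s(4)[OF that] by simp
  qed
  let ?K = "K_asym d m M v"
  note K = K_asym_nth[OF measurement_carrier measurement_hermitian v]
  have diag: "?K $$ (i, i) = complex_of_real (2 * \<gamma>\<^sup>2 - 2)" if "i < m" for i
  proof -
    have "v i \<bullet>c (M *\<^sub>v v i) = complex_of_real (y i)"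
      using cnj_cscalar_prod[OF measurement_mult_carrier[OF v[OF that]] v[OF that]] Mvv[OF that] by simp
    then have "?K $$ (i, i) = complex_of_real (2 * \<gamma>\<^sup>2 - 2 * (y i)\<^sup>2)"
      using that v by (simp add: K measurement_isometry vv Mvv power2_eq_square)
    also have "(y i)\<^sup>2 = 1" using y[OF that] by auto
    finally show ?thesis by simp
  qed
  have off: "cmod (?K $$ (i, j)) \<le> 8 * \<gamma>\<^sup>2 * t" if ij: "i < m" "j < m" "i \<noteq> j" for i j
  proof -
    define p where "p = (\<lambda>i j. (M *\<^sub>v v i) \<bullet>c v j)"
    have p: "(cmod (p i j))\<^sup>2 \<le> 4 * \<gamma>\<^sup>2 * t" if "i < m" "j < m" "i \<noteq> j" for i j
    proof -
      have "(cmod (p i j))\<^sup>2 = 4 * \<gamma>\<^sup>2 * ((s i)\<^sup>2 * (s j)\<^sup>2 * (cmod (coord_dot ?n (x i) (x j)))\<^sup>2)"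
        using that by (simp add: p_def Mv norm_mult power_mult_distrib)
      also have "\<dots> \<le> 4 * \<gamma>\<^sup>2 * (1 * 1 * t)"
        using s[OF that(1)] s[OF that(2)] small[OF that] norm_x[OF that(2)]
        by (intro mult_left_mono mult_mono) (auto simp: power_le_one)
      finally show ?thesis by simp
    qed
    have vM: "v i \<bullet>c (M *\<^sub>v v j) = cnj (p j i)" "v j \<bullet>c (M *\<^sub>v v i) = cnj (p i j)"
      using ij v measurement_mult_carrier unfolding p_def by (simp_all add: cnj_cscalar_prod[of _ d])
    \<comment> \<open>By the isometry property the first two terms of \<open>K\<close> carry inner
      products of \<open>v i\<close> and \<open>v j\<close>, which vanish for distinct
      indices.\<close>
    have "?K $$ (i, j) = - (p i j * p j i) - cnj (p j i) * cnj (p i j)"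
      using ij by (simp add: K vv vM) (simp add: p_def)
    then have "cmod (?K $$ (i, j)) \<le> cmod (p i j * p j i) + cmod (cnj (p j i) * cnj (p i j))"
      by (metis norm_minus_cancel norm_triangle_ineq4)
    also have "\<dots> = 2 * (cmod (p i j) * cmod (p j i))" by (simp add: norm_mult)
    \<comment> \<open>The arithmetic-geometric mean inequality lets the bound on each
      \<open>p\<close> be used separately, without comparing \<open>p i j\<close> with
      \<open>p j i\<close>.\<close>
    also have "\<dots> \<le> (cmod (p i j))\<^sup>2 + (cmod (p j i))\<^sup>2"
      using sum_squares_bound[of "cmod (p i j)" "cmod (p j i)"] by simp
    also have "\<dots> \<le> 8 * \<gamma>\<^sup>2 * t"
      using p[of i j] p[of j i] ij by simp
    finally show ?thesis .
  qed
  show ?thesis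
  proof (rule min_eigenvalue_ge[OF K_asym_carrier m])
    show "cnj (?K $$ (i, j)) = ?K $$ (j, i)" if "i < m" "j < m" for i j
      using v that by (intro K_asym_hermitian)
    fix z assume "eigenvalue ?K (complex_of_real z)"
    then obtain i where i: "i < m"
      "cmod (complex_of_real z - ?K $$ (i, i)) \<le> (\<Sum>j\<in>{..<m} - {i}. cmod (?K $$ (i, j)))"
      by (rule Gershgorin[OF K_asym_carrier])
    have "complex_of_real z - ?K $$ (i, i) = complex_of_real (z - (2 * \<gamma>\<^sup>2 - 2))"
      using i(1) by (simp add: diag)
    then have "\<bar>z - (2 * \<gamma>\<^sup>2 - 2)\<bar> \<le> (\<Sum>j\<in>{..<m} - {i}. cmod (?K $$ (i, j)))"
      using i(2) by (simp only: norm_of_real)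
    also have "\<dots> \<le> (\<Sum>j\<in>{..<m} - {i}. 8 * \<gamma>\<^sup>2 * t)"
      using i(1) by (intro sum_mono off) auto
    also have "\<dots> \<le> (\<Sum>j\<in>{..<m}. 8 * \<gamma>\<^sup>2 * t)"
      using t by (intro sum_mono2) auto
    finally have "2 * \<gamma>\<^sup>2 - 2 - real m * (8 * \<gamma>\<^sup>2 * t) \<le> z" by simp
    moreover have "2 * \<gamma>\<^sup>2 * (1 - 1 / \<gamma>\<^sup>2 - 4 * real m * t) = 2 * \<gamma>\<^sup>2 - 2 - real m * (8 * \<gamma>\<^sup>2 * t)"
      using \<gamma> by (simp add: field_simps)
    ultimately show "2 * \<gamma>\<^sup>2 * (1 - 1 / \<gamma>\<^sup>2 - 4 * real m * t) \<le> z" by simp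
  qed
qed

end

subsection \<open>Constants\<close>

text \<open>The logarithm of the number of pairs is absorbed crudely:
  \<open>ln 2 + 2 ln m <= 2 m\<close>. This leaves \<open>32 m^2/d\<close> and
  \<open>16 (m/d) ln (2/\<delta>)\<close>, and \<open>32 + 16 = 48\<close> is the universal
  constant.\<close>

lemma overlap_threshold_bound:
  assumes m: "m \<ge> 2" and d: "d \<ge> 2" and \<delta>: "0 < \<delta>" "\<delta> < 1"
  shows "4 * real m * (4 / real d * ln (4 * (real m)\<^sup>2 / \<delta>))
    \<le> 48 * max ((real m)\<^sup>2 / real d) (real m / real d * ln (2 / \<delta>))"
proof -
  have "ln (4 * (real m)\<^sup>2 / \<delta>) = ln (2 * (real m)\<^sup>2 * (2 / \<delta>))" by (simp add: field_simps)
  also have "\<dots> = ln 2 + 2 * ln (real m) + ln (2 / \<delta>)"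
    using m \<delta> by (simp add: ln_mult ln_realpow del: times_divide_eq_right)
  also have "\<dots> \<le> 2 * real m + ln (2 / \<delta>)"
    using m ln_le_minus_one[of "real m"] ln_le_minus_one[of 2] by simp
  finally have "4 * real m * (4 / real d * ln (4 * (real m)\<^sup>2 / \<delta>))
      \<le> 4 * real m * (4 / real d * (2 * real m + ln (2 / \<delta>)))"
    by (intro mult_left_mono) auto
  also have "\<dots> = 32 * ((real m)\<^sup>2 / real d) + 16 * (real m / real d * ln (2 / \<delta>))"
    using d by (simp add: field_simps power2_eq_square)
  also have "\<dots> \<le> 48 * max ((real m)\<^sup>2 / real d) (real m / real d * ln (2 / \<delta>))"
  proof -
    have "32 * a + 16 * b \<le> 48 * max a b" for a b :: real by (simp add: max_def)
    then show ?thesis .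
  qed
  finally show ?thesis .
qed

text \<open>The thresholds make each subtracted term at most 1/4. The factor
  \<open>1 + ln (2/\<delta>)\<close> together with \<open>m <= m^2\<close> dominates both entries of
  the maximum.\<close>

lemma eig_bound_pos:
  assumes C: "C > 0" and \<delta>: "0 < \<delta>" "\<delta> < 1"
    and m: "m \<ge> 2" and d: "d \<ge> 2" and \<gamma>: "\<gamma> \<ge> 2"
    and dm: "real d \<ge> 4 * C * (1 + ln (2 / \<delta>)) * (real m)\<^sup>2"
  shows "eig_bound C \<gamma> \<delta> m d > 0"
proof -
  define L where "L = 1 + ln (2 / \<delta>)"
  have L: "L \<ge> 1" using \<delta> by (simp add: L_def)
  have mm: "real m \<le> (real m)\<^sup>2" using m by (simp add: power2_eq_square)
  have "max ((real m)\<^sup>2) (real m * ln (2 / \<delta>)) \<le> (real m)\<^sup>2 * L"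
  proof (rule max.boundedI)
    show "(real m)\<^sup>2 \<le> (real m)\<^sup>2 * L" using L mult_left_mono[of 1 L "(real m)\<^sup>2"] by simp
    show "real m * ln (2 / \<delta>) \<le> (real m)\<^sup>2 * L" using mm L by (intro mult_mono) (auto simp: L_def)
  qed
  moreover have "C * ((real m)\<^sup>2 * L) \<le> real d / 4" using dm by (simp add: L_def algebra_simps)
  ultimately have "C * max ((real m)\<^sup>2) (real m * ln (2 / \<delta>)) \<le> real d / 4"
    using C by (meson mult_left_mono less_imp_le order_trans)
  then have "C * max ((real m)\<^sup>2) (real m * ln (2 / \<delta>)) / real d \<le> 1 / 4"
    using d by (simp add: field_simps)
  moreover have "max ((real m)\<^sup>2 / real d) (real m / real d * ln (2 / \<delta>))
      = max ((real m)\<^sup>2) (real m * ln (2 / \<delta>)) / real d"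
    using d by (simp add: max_def divide_le_cancel)
  ultimately have "C * max ((real m)\<^sup>2 / real d) (real m / real d * ln (2 / \<delta>)) \<le> 1 / 4"
    by simp
  moreover have "1 / \<gamma>\<^sup>2 \<le> 1 / 4"
    using power_mono[of 2 \<gamma> 2] \<gamma> by (simp add: field_simps)
  ultimately have "1 - 1 / \<gamma>\<^sup>2 - C * max ((real m)\<^sup>2 / real d) (real m / real d * ln (2 / \<delta>)) > 0"
    by linarith
  then show ?thesis using \<gamma> by (simp add: eig_bound_def)
qed

theorem theorem4p4:
  shows "\<exists>C\<^sub>2::real. C\<^sub>2 > 0 \<and>
    (\<forall>(m::nat) (d::nat) (\<gamma>::real) (\<delta>::real) (y :: nat \<Rightarrow> real)
        (e :: nat \<Rightarrow> complex vec) (f :: nat \<Rightarrow> complex vec).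
       m \<ge> 2 \<and> even m \<and> d \<ge> 2 \<and> even d \<and> \<gamma> > 1 \<and> 0 < \<delta> \<and> \<delta> < 1 \<and>
       (\<forall>j<m. y j = 1 \<or> y j = -1) \<and>
       card {j. j < m \<and> y j = 1} = card {j. j < m \<and> y j = -1} \<and>
       half_split d e f \<longrightarrow>
       (\<exists>A \<in> sets (Pi\<^sub>M {..<m} (\<lambda>_. uniform_sphere (d div 2))).
          measure (Pi\<^sub>M {..<m} (\<lambda>_. uniform_sphere (d div 2))) A \<ge> 1 - \<delta> \<and>
          (\<forall>x\<in>A. \<forall>v.
             global_min d m (measurement d \<gamma> e f) y v \<and>
             (\<forall>j<m. proj_onto d (d div 2) e *\<^sub>v v j =
                complex_of_real (sqrt (1 / 2 * (1 + y j / \<gamma>))) \<cdot>\<^sub>v from_coords d (d div 2) e (x j)) \<longrightarrow>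
             min_eigenvalue (K_asym d m (measurement d \<gamma> e f) v) \<ge> eig_bound C\<^sub>2 \<gamma> \<delta> m d))) \<and>
    (\<forall>\<delta>::real. 0 < \<delta> \<and> \<delta> < 1 \<longrightarrow>
       (\<exists>\<gamma>\<^sub>0 > 1. \<exists>q :: real poly. \<forall>(\<gamma>::real) (m::nat) (d::nat).
          m \<ge> 2 \<and> even m \<and> d \<ge> 2 \<and> even d \<and> \<gamma> \<ge> \<gamma>\<^sub>0 \<and> real d \<ge> poly q (real m) \<longrightarrow>
          eig_bound C\<^sub>2 \<gamma> \<delta> m d > 0))"
proof (rule exI[of _ 48], intro conjI allI impI)
  fix m d :: nat and \<gamma> \<delta> :: real and y :: "nat \<Rightarrow> real" and e f :: "nat \<Rightarrow> complex vec"
  assume "m \<ge> 2 \<and> even m \<and> d \<ge> 2 \<and> even d \<and> \<gamma> > 1 \<and> 0 < \<delta> \<and> \<delta> < 1 \<and>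
       (\<forall>j<m. y j = 1 \<or> y j = -1) \<and>
       card {j. j < m \<and> y j = 1} = card {j. j < m \<and> y j = -1} \<and>
       half_split d e f"
  then have m: "m \<ge> 2" and d: "d \<ge> 2" "even d" and \<gamma>: "\<gamma> > 1" and \<delta>: "0 < \<delta>" "\<delta> < 1"
    and y: "\<And>j. j < m \<Longrightarrow> y j = 1 \<or> y j = -1" and hs: "half_split d e f"
    by auto
  define L where "L = ln (4 * (real m)\<^sup>2 / \<delta>)"
  \<comment> \<open>Chosen so that with \<open>n = d/2\<close> the tail exponent
    \<open>n t / 2\<close> is exactly \<open>L\<close>; then \<open>m^2 * 4 * exp (-L)\<close>
    equals \<open>\<delta>\<close>.\<close>
  define t where "t = 4 / real d * L"
  have "1 \<le> (real m)\<^sup>2" using m by (simp add: one_le_power)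
  then have "4 * (real m)\<^sup>2 / \<delta> > 1" using \<delta> by (simp add: field_simps)
  then have "L > 0" by (simp add: L_def)
  then have t: "t > 0" using d by (simp add: t_def)
  let ?N = "Pi\<^sub>M {..<m} (\<lambda>_. uniform_sphere (d div 2))"
  \<comment> \<open>The event restricts only the directions \<open>x\<close>, so one set serves all
    global minima \<open>v\<close> having those directions.\<close>
  define A where "A = {x \<in> space ?N. \<forall>i<m. \<forall>j<m. i \<noteq> j \<longrightarrow>
     (cmod (coord_dot (d div 2) (x i) (x j)))\<^sup>2 \<le> t * (coord_norm (d div 2) (x j))\<^sup>2}"
  have "real (d div 2) * t / 2 = L"
    using d by (simp add: t_def real_of_nat_div)
  moreover have "exp (- L) = \<delta> / (4 * (real m)\<^sup>2)"
    unfolding L_def using m \<delta> by (simp add: exp_minus)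
  ultimately have prob: "(real m)\<^sup>2 * (4 * exp (- (real (d div 2) * t / 2))) = \<delta>"
    using m by simp
  show "\<exists>A \<in> sets ?N. measure ?N A \<ge> 1 - \<delta> \<and>
          (\<forall>x\<in>A. \<forall>v.
             global_min d m (measurement d \<gamma> e f) y v \<and>
             (\<forall>j<m. proj_onto d (d div 2) e *\<^sub>v v j =
                complex_of_real (sqrt (1 / 2 * (1 + y j / \<gamma>))) \<cdot>\<^sub>v from_coords d (d div 2) e (x j)) \<longrightarrow>
             min_eigenvalue (K_asym d m (measurement d \<gamma> e f) v) \<ge> eig_bound 48 \<gamma> \<delta> m d)"
  proof (intro bexI[of _ A] conjI ballI allI impI)
    show "A \<in> sets ?N" unfolding A_def by (rule sphere_product_pairs(1)[OF t])
    show "1 - \<delta> \<le> measure ?N A"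
      using sphere_product_pairs(2)[OF t, of m "d div 2"] unfolding prob A_def .
    fix x v
    assume x: "x \<in> A" and v: "global_min d m (measurement d \<gamma> e f) y v \<and>
       (\<forall>j<m. proj_onto d (d div 2) e *\<^sub>v v j =
          complex_of_real (sqrt (1 / 2 * (1 + y j / \<gamma>))) \<cdot>\<^sub>v from_coords d (d div 2) e (x j))"
    have "eig_bound 48 \<gamma> \<delta> m d \<le> 2 * \<gamma>\<^sup>2 * (1 - 1 / \<gamma>\<^sup>2 - 4 * real m * t)"
      unfolding eig_bound_def t_def L_def
      using overlap_threshold_bound[OF m d(1) \<delta>] by (intro mult_left_mono) auto
    also have "\<dots> \<le> min_eigenvalue (K_asym d m (measurement d \<gamma> e f) v)"
      using x v m t y by (intro min_eigenvalue_K_asym[OF hs d(2) \<gamma>]) (auto simp: A_def)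
    finally show "eig_bound 48 \<gamma> \<delta> m d \<le> min_eigenvalue (K_asym d m (measurement d \<gamma> e f) v)" .
  qed
next
  fix \<delta> :: real assume \<delta>: "0 < \<delta> \<and> \<delta> < 1"
  show "\<exists>\<gamma>\<^sub>0 > 1. \<exists>q :: real poly. \<forall>(\<gamma>::real) (m::nat) (d::nat).
      m \<ge> 2 \<and> even m \<and> d \<ge> 2 \<and> even d \<and> \<gamma> \<ge> \<gamma>\<^sub>0 \<and> real d \<ge> poly q (real m) \<longrightarrow>
      eig_bound 48 \<gamma> \<delta> m d > 0"
    using \<delta>
    \<comment> \<open>The witnesses are the hypotheses of \<open>eig_bound_pos\<close> at
      \<open>C = 48\<close>: \<open>\<gamma>\<close> at least 2, and a quadratic monomial in
      \<open>m\<close> whose coefficient depends only on \<open>\<delta>\<close>.\<close>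
    by (intro exI[of _ 2] conjI exI[of _ "monom (4 * 48 * (1 + ln (2 / \<delta>))) 2"] allI impI eig_bound_pos)
      (auto simp: poly_monom)
qed simp

end
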